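(* Let $(P,\theta,\omega)$ be a fully regular $G$-structure with connection, with classifying map $h:P\to X_{(\theta,\omega)}$, let $A_{(\theta,\omega)}:=X_{(\theta,\omega)}\times(\mathbb R^n\oplus\mathfrak g)\to X_{(\theta,\omega)}$ be the trivial vector bundle, and let $H=(\theta,\omega):TP\to A_{(\theta,\omega)}$ be the fiberwise isomorphism covering $h$ given by $H(\xi)=(h(p),\theta(\xi),\omega(\xi))$ for $\xi\in T_pP$. For every $k$, the image of the (injective) pullback map $H^*:\Omega^k(A_{(\theta,\omega)})\to\Omega^k(P)$ is the space of invariant $k$-forms, so that one has an isomorphism $$H^*:\Omega^k(A_{(\theta,\omega)})\xrightarrow{\ \sim\ }\Omega^k(P,\theta,\omega).$$
   Context: Let $G\subset \mathrm{GL}_n(\mathbb R)$ be a closed subgroup with Lie algebra $\mathfrak g$. A $G$-structure is a pair $(P,\theta)$ where $P$ is a manifold with a smooth right $G$-action which is proper, effective and locally free, $\dim P=n+\dim G$, and $\theta\in\Omega^1(P,\mathbb R^n)$ is pointwise surjective and tensorial: $\theta(\tilde\alpha)=0$ for all $\alpha\in\mathfrak g$ (where $\tilde\alpha_p=\frac{d}{dt}|_{t=0}\,p\exp(t\alpha)$), and $g^*\theta=g^{-1}\cdot\theta$ for all $g\in G$. A connection on $(P,\theta)$ is a form $\omega\in\Omega^1(P,\mathfrak g)$ with $\omega(\tilde\alpha)=\alpha$ for all $\alpha\in\mathfrak g$ and $g^*\omega=\mathrm{Ad}_{g^{-1}}\circ\omega$ for all $g\in G$. A local equivalence of $(P,\theta,\omega)$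 is a $G$-equivariant diffeomorphism $\Phi$ between $G$-saturated open subsets of $P$ such that $\Phi^*\theta=\theta$ and $\Phi^*\omega=\omega$. An invariant $k$-form is $\Omega\in\Omega^k(P)$ with $\Phi^*\Omega=\Omega$ for every local equivalence $\Phi$; the space of these is $\Omega^k(P,\theta,\omega)$, and $\mathrm{Inv}(P,\theta,\omega)=\Omega^0(P,\theta,\omega)$. $(P,\theta,\omega)$ is fully regular if the dimension $d$ (the rank) of $\mathcal I_p=\{\mathrm d_pI: I\in\mathrm{Inv}(P,\theta,\omega)\}\subset T_p^*P$ does not depend on $p\in P$. In that case the quotient $X_{(\theta,\omega)}=P/\!\sim$, where $p\sim q$ iff some local equivalence maps $p$ to $q$, is a smooth manifold of dimension $d$ (the classifying manifold) for which the quotient map $h:P\to X_{(\theta,\omega)}$ (the classifying map) is a submersion; it satisfies $h^*C^\infty(X_{(\theta,\omega)})=\mathrm{Inv}(P,\theta,\omega)$. For a vector bundle $A\to X$, $\Omega^k(A)$ denotes the space of smooth sections of $\wedge^kA^*\to X$; the pullback is $(H^*\eta)_p(\xi_1,\dots,\xi_k)=\eta_{h(p)}(H\xi_1,\dots,H\xi_k)$. *)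

theory Defs
  imports "HOL-Analysis.Analysis"
begin

section \<open>Smooth maps between subsets of Euclidean spaces\<close>

primrec Ck_on :: "nat \<Rightarrow> 'a::euclidean_space set \<Rightarrow> ('a \<Rightarrow> 'b::real_normed_vector) \<Rightarrow> bool" where
  "Ck_on 0 S f \<longleftrightarrow> continuous_on S f"
| "Ck_on (Suc k) S f \<longleftrightarrow> (\<forall>x\<in>S. f differentiable (at x)) \<and>
     (\<forall>v. Ck_on k S (\<lambda>x. frechet_derivative f (at x) v))"

text \<open>Arbitrary domains are allowed: a map is smooth if it has local smooth extensions to
  open sets of the ambient space. On open sets this is ordinary smoothness; on an embedded
  submanifold (a linear subspace, or a closed matrix group) it is smoothness in the
  submanifold structure.\<close>

definition smooth_on :: "'a::euclidean_space set \<Rightarrow> ('a \<Rightarrow> 'b::real_normed_vector) \<Rightarrow> bool" where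
  "smooth_on S f \<longleftrightarrow> (\<forall>x\<in>S. \<exists>W F. open W \<and> x \<in> W \<and> (\<forall>k. Ck_on k W F) \<and> (\<forall>y\<in>S \<inter> W. F y = f y))"


section \<open>Smooth manifolds\<close>

text \<open>The charts take values in a linear subspace \<open>model M\<close> of \<open>'e\<close>, so that the dimension
  of a manifold is a number not determined by its type and may be zero. Whenever tangent vectors
  of \<open>M\<close> are used below (except for the targets of differentials), \<open>model M = UNIV\<close>.\<close>

record ('p, 'e) mfd =
  mtop :: "'p topology"
  model :: "'e set"
  atlas :: "('p set \<times> ('p \<Rightarrow> 'e)) set"

abbreviation pts :: "('p, 'e) mfd \<Rightarrow> 'p set" where
  "pts M \<equiv> topspace (mtop M)"

text \<open>No separation or countability axioms at this point: quotients such as the classifying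
  manifold need not be Hausdorff.\<close>

definition smooth_manifold :: "('p, 'e::euclidean_space) mfd \<Rightarrow> bool" where
  "smooth_manifold M \<longleftrightarrow>
     subspace (model M) \<and>
     (\<forall>(U, \<phi>)\<in>atlas M. openin (mtop M) U \<and> openin (top_of_set (model M)) (\<phi> ` U) \<and>
        homeomorphic_map (subtopology (mtop M) U) (top_of_set (\<phi> ` U)) \<phi>) \<and>
     (\<Union>(fst ` atlas M) = pts M) \<and>
     (\<forall>(U, \<phi>)\<in>atlas M. \<forall>(V, \<psi>)\<in>atlas M.
        smooth_on (\<phi> ` (U \<inter> V)) (\<lambda>x. \<psi> (inv_into U \<phi> x)))"

definition smooth_fun :: "('p, 'e::euclidean_space) mfd \<Rightarrow> ('p \<Rightarrow> 'w::real_normed_vector) \<Rightarrow> bool" where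
  "smooth_fun M f \<longleftrightarrow> (\<forall>(U, \<phi>)\<in>atlas M. smooth_on (\<phi> ` U) (\<lambda>x. f (inv_into U \<phi> x)))"

definition smooth_map ::
    "('p, 'e::euclidean_space) mfd \<Rightarrow> 'p set \<Rightarrow> ('q, 'f::euclidean_space) mfd \<Rightarrow> ('p \<Rightarrow> 'q) \<Rightarrow> bool" where
  "smooth_map M D N f \<longleftrightarrow>
     continuous_map (subtopology (mtop M) D) (mtop N) f \<and>
     (\<forall>(U, \<phi>)\<in>atlas M. \<forall>(V, \<psi>)\<in>atlas N.
        smooth_on (\<phi> ` {p \<in> U \<inter> D. f p \<in> V}) (\<lambda>x. \<psi> (f (inv_into U \<phi> x))))"


section \<open>Tangent vectors and differential forms\<close>

text \<open>The tangent space at \<open>p\<close> is identified with the model space through a chart at \<open>p\<close>,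
  chosen once for every point. All tangent vectors at \<open>p\<close> are expressed in this chart;
  coordinate vectors of other charts are converted by \<open>coord_vec\<close>.\<close>

definition chart_at :: "('p, 'e) mfd \<Rightarrow> 'p \<Rightarrow> 'p set \<times> ('p \<Rightarrow> 'e)" where
  "chart_at M p = (SOME c. c \<in> atlas M \<and> p \<in> fst c)"

definition coords_at :: "('p, 'e) mfd \<Rightarrow> 'p \<Rightarrow> 'p \<Rightarrow> 'e" where
  "coords_at M p = snd (chart_at M p)"

definition inv_coords_at :: "('p, 'e) mfd \<Rightarrow> 'p \<Rightarrow> 'e \<Rightarrow> 'p" where
  "inv_coords_at M p = inv_into (fst (chart_at M p)) (coords_at M p)"

definition tangent_map ::
    "('p, 'e::euclidean_space) mfd \<Rightarrow> ('q, 'f::euclidean_space) mfd \<Rightarrow> ('p \<Rightarrow> 'q) \<Rightarrow> 'p \<Rightarrow> 'e \<Rightarrow> 'f" where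
  "tangent_map M N f p =
     frechet_derivative (\<lambda>x. coords_at N (f p) (f (inv_coords_at M p x))) (at (coords_at M p p))"

definition differential :: "('p, 'e::euclidean_space) mfd \<Rightarrow> ('p \<Rightarrow> real) \<Rightarrow> 'p \<Rightarrow> 'e \<Rightarrow>\<^sub>L real" where
  "differential M I p =
     Blinfun (frechet_derivative (\<lambda>x. I (inv_coords_at M p x)) (at (coords_at M p p)))"

definition velocity :: "('p, 'e::euclidean_space) mfd \<Rightarrow> (real \<Rightarrow> 'p) \<Rightarrow> 'e" where
  "velocity M c = vector_derivative (\<lambda>t. coords_at M (c 0) (c t)) (at 0)"

definition coord_vec ::
    "('p, 'e::euclidean_space) mfd \<Rightarrow> 'p set \<times> ('p \<Rightarrow> 'e) \<Rightarrow> 'p \<Rightarrow> 'e \<Rightarrow> 'e" where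
  "coord_vec M c p =
     frechet_derivative (\<lambda>x. coords_at M p (inv_into (fst c) (snd c) x)) (at (snd c p))"

text \<open>Alternating \<open>k\<close>-linear forms on a vector space \<open>V\<close> that is a subspace of a type. Argument
  tuples are lists of length \<open>k\<close>; forms are extended by 0 outside \<open>V\<^sup>k\<close>, so that equality of
  functions is equality of forms.\<close>

definition alternating_form :: "nat \<Rightarrow> 'v::real_vector set \<Rightarrow> ('v list \<Rightarrow> real) \<Rightarrow> bool" where
  "alternating_form k V f \<longleftrightarrow>
     (\<forall>vs. \<not> (length vs = k \<and> set vs \<subseteq> V) \<longrightarrow> f vs = 0) \<and>
     (\<forall>vs i u v a b. length vs = k \<and> set vs \<subseteq> V \<and> i < k \<and> u \<in> V \<and> v \<in> V \<longrightarrow>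
        f (vs[i := a *\<^sub>R u + b *\<^sub>R v]) = a * f (vs[i := u]) + b * f (vs[i := v])) \<and>
     (\<forall>vs i j. length vs = k \<and> set vs \<subseteq> V \<and> i < k \<and> j < k \<and> i \<noteq> j \<and> vs ! i = vs ! j \<longrightarrow> f vs = 0)"

definition diff_forms :: "('p, 'e::euclidean_space) mfd \<Rightarrow> nat \<Rightarrow> ('p \<Rightarrow> 'e list \<Rightarrow> real) set" where
  "diff_forms M k = {\<Omega>.
     (\<forall>p\<in>pts M. alternating_form k UNIV (\<Omega> p)) \<and>
     (\<forall>p vs. p \<notin> pts M \<longrightarrow> \<Omega> p vs = 0) \<and>
     (\<forall>(U, \<phi>)\<in>atlas M. \<forall>vs. length vs = k \<longrightarrow>
        smooth_on (\<phi> ` U)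
          (\<lambda>x. let p = inv_into U \<phi> x in \<Omega> p (map (coord_vec M (U, \<phi>) p) vs)))}"

definition vector_valued_one_form ::
    "('p, 'e::euclidean_space) mfd \<Rightarrow> ('p \<Rightarrow> 'e \<Rightarrow> 'w::real_normed_vector) \<Rightarrow> bool" where
  "vector_valued_one_form M \<theta> \<longleftrightarrow>
     (\<forall>p\<in>pts M. linear (\<theta> p)) \<and>
     (\<forall>(U, \<phi>)\<in>atlas M. \<forall>v. smooth_on (\<phi> ` U)
        (\<lambda>x. let p = inv_into U \<phi> x in \<theta> p (coord_vec M (U, \<phi>) p v)))"

text \<open>Smooth sections of \<open>\<Lambda>\<^sup>k A\<^sup>* \<rightarrow> X\<close> for the trivial vector bundle \<open>A = X \<times> V\<close>; the fibre over
  any \<open>x\<close> is identified with \<open>V\<close>.\<close>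

definition trivial_bundle_forms ::
    "('x, 'e::euclidean_space) mfd \<Rightarrow> 'v::real_vector set \<Rightarrow> nat \<Rightarrow> ('x \<Rightarrow> 'v list \<Rightarrow> real) set" where
  "trivial_bundle_forms X V k = {\<eta>.
     (\<forall>x\<in>pts X. alternating_form k V (\<eta> x)) \<and>
     (\<forall>x ws. x \<notin> pts X \<longrightarrow> \<eta> x ws = 0) \<and>
     (\<forall>ws. length ws = k \<and> set ws \<subseteq> V \<longrightarrow> smooth_fun X (\<lambda>x. \<eta> x ws))}"


section \<open>Matrix groups\<close>

definition mat_exp :: "real^'n^'n \<Rightarrow> real^'n^'n" where
  "mat_exp A = (\<Sum>k. (1 / fact k) *\<^sub>R (((**) A ^^ k) (mat 1)))"

definition closed_matrix_group :: "(real^'n^'n) set \<Rightarrow> bool" where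
  "closed_matrix_group G \<longleftrightarrow>
     closedin (top_of_set {A. invertible A}) G \<and> mat 1 \<in> G \<and>
     (\<forall>g\<in>G. \<forall>h\<in>G. g ** h \<in> G) \<and> (\<forall>g\<in>G. matrix_inv g \<in> G)"

definition lie_algebra :: "(real^'n^'n) set \<Rightarrow> (real^'n^'n) set" where
  "lie_algebra G = {\<alpha>. \<forall>t. mat_exp (t *\<^sub>R \<alpha>) \<in> G}"


section \<open>\<open>G\<close>-structures with connection\<close>

definition smooth_right_action ::
    "(real^'n^'n) set \<Rightarrow> ('p, 'e::euclidean_space) mfd \<Rightarrow> ('p \<Rightarrow> real^'n^'n \<Rightarrow> 'p) \<Rightarrow> bool" where
  "smooth_right_action G P act \<longleftrightarrow>
     (\<forall>p\<in>pts P. act p (mat 1) = p) \<and>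
     (\<forall>p\<in>pts P. \<forall>g\<in>G. \<forall>h\<in>G. act (act p g) h = act p (g ** h)) \<and>
     continuous_map (prod_topology (mtop P) (top_of_set G)) (mtop P) (\<lambda>(p, g). act p g) \<and>
     (\<forall>(U, \<phi>)\<in>atlas P. \<forall>(V, \<psi>)\<in>atlas P.
        smooth_on {(x, g). x \<in> \<phi> ` U \<and> g \<in> G \<and> act (inv_into U \<phi> x) g \<in> V}
          (\<lambda>(x, g). \<psi> (act (inv_into U \<phi> x) g)))"

definition proper_action ::
    "(real^'n^'n) set \<Rightarrow> ('p, 'e) mfd \<Rightarrow> ('p \<Rightarrow> real^'n^'n \<Rightarrow> 'p) \<Rightarrow> bool" where
  "proper_action G P act \<longleftrightarrow>
     proper_map (prod_topology (mtop P) (top_of_set G)) (prod_topology (mtop P) (mtop P))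
       (\<lambda>(p, g). (p, act p g))"

definition effective_action where
  "effective_action G P act \<longleftrightarrow> (\<forall>g\<in>G. (\<forall>p\<in>pts P. act p g = p) \<longrightarrow> g = mat 1)"

definition locally_free_action ::
    "(real^'n^'n) set \<Rightarrow> ('p, 'e) mfd \<Rightarrow> ('p \<Rightarrow> real^'n^'n \<Rightarrow> 'p) \<Rightarrow> bool" where
  "locally_free_action G P act \<longleftrightarrow> (\<forall>p\<in>pts P. discrete {g\<in>G. act p g = p})"

definition fund_vec ::
    "('p, 'e::euclidean_space) mfd \<Rightarrow> ('p \<Rightarrow> real^'n^'n \<Rightarrow> 'p) \<Rightarrow> real^'n^'n \<Rightarrow> 'p \<Rightarrow> 'e" where
  "fund_vec P act \<alpha> p = velocity P (\<lambda>t. act p (mat_exp (t *\<^sub>R \<alpha>)))"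

definition G_structure ::
    "(real^'n^'n) set \<Rightarrow> ('p, 'e::euclidean_space) mfd \<Rightarrow> ('p \<Rightarrow> real^'n^'n \<Rightarrow> 'p) \<Rightarrow>
     ('p \<Rightarrow> 'e \<Rightarrow> real^'n) \<Rightarrow> bool" where
  "G_structure G P act \<theta> \<longleftrightarrow>
     closed_matrix_group G \<and>
     smooth_manifold P \<and> Hausdorff_space (mtop P) \<and> second_countable (mtop P) \<and>
     model P = UNIV \<and> DIM('e) = CARD('n) + dim (lie_algebra G) \<and>
     smooth_right_action G P act \<and> proper_action G P act \<and>
     effective_action G P act \<and> locally_free_action G P act \<and>
     vector_valued_one_form P \<theta> \<and>
     (\<forall>p\<in>pts P. surj (\<theta> p)) \<and>
     (\<forall>p\<in>pts P. \<forall>\<alpha>\<in>lie_algebra G. \<theta> p (fund_vec P act \<alpha> p) = 0) \<and>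
     (\<forall>p\<in>pts P. \<forall>g\<in>G. \<forall>\<xi>.
        \<theta> (act p g) (tangent_map P P (\<lambda>q. act q g) p \<xi>) = matrix_inv g *v \<theta> p \<xi>)"

definition is_connection ::
    "(real^'n^'n) set \<Rightarrow> ('p, 'e::euclidean_space) mfd \<Rightarrow> ('p \<Rightarrow> real^'n^'n \<Rightarrow> 'p) \<Rightarrow>
     ('p \<Rightarrow> 'e \<Rightarrow> real^'n^'n) \<Rightarrow> bool" where
  "is_connection G P act \<omega> \<longleftrightarrow>
     vector_valued_one_form P \<omega> \<and>
     (\<forall>p\<in>pts P. \<forall>\<xi>. \<omega> p \<xi> \<in> lie_algebra G) \<and>
     (\<forall>p\<in>pts P. \<forall>\<alpha>\<in>lie_algebra G. \<omega> p (fund_vec P act \<alpha> p) = \<alpha>) \<and>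
     (\<forall>p\<in>pts P. \<forall>g\<in>G. \<forall>\<xi>.
        \<omega> (act p g) (tangent_map P P (\<lambda>q. act q g) p \<xi>) = matrix_inv g ** \<omega> p \<xi> ** g)"


section \<open>Local equivalences, invariant forms, and the classifying manifold\<close>

definition local_equivalence ::
    "(real^'n^'n) set \<Rightarrow> ('p, 'e::euclidean_space) mfd \<Rightarrow> ('p \<Rightarrow> real^'n^'n \<Rightarrow> 'p) \<Rightarrow>
     ('p \<Rightarrow> 'e \<Rightarrow> real^'n) \<Rightarrow> ('p \<Rightarrow> 'e \<Rightarrow> real^'n^'n) \<Rightarrow> 'p set \<Rightarrow> 'p set \<Rightarrow> ('p \<Rightarrow> 'p) \<Rightarrow> bool" where
  "local_equivalence G P act \<theta> \<omega> U V \<Phi> \<longleftrightarrow>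
     openin (mtop P) U \<and> openin (mtop P) V \<and>
     (\<forall>p\<in>U. \<forall>g\<in>G. act p g \<in> U) \<and> (\<forall>p\<in>V. \<forall>g\<in>G. act p g \<in> V) \<and>
     bij_betw \<Phi> U V \<and> smooth_map P U P \<Phi> \<and> smooth_map P V P (inv_into U \<Phi>) \<and>
     (\<forall>p\<in>U. \<forall>g\<in>G. \<Phi> (act p g) = act (\<Phi> p) g) \<and>
     (\<forall>p\<in>U. \<forall>\<xi>. \<theta> (\<Phi> p) (tangent_map P P \<Phi> p \<xi>) = \<theta> p \<xi>) \<and>
     (\<forall>p\<in>U. \<forall>\<xi>. \<omega> (\<Phi> p) (tangent_map P P \<Phi> p \<xi>) = \<omega> p \<xi>)"

definition invariant_forms ::
    "(real^'n^'n) set \<Rightarrow> ('p, 'e::euclidean_space) mfd \<Rightarrow> ('p \<Rightarrow> real^'n^'n \<Rightarrow> 'p) \<Rightarrow>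
     ('p \<Rightarrow> 'e \<Rightarrow> real^'n) \<Rightarrow> ('p \<Rightarrow> 'e \<Rightarrow> real^'n^'n) \<Rightarrow> nat \<Rightarrow> ('p \<Rightarrow> 'e list \<Rightarrow> real) set" where
  "invariant_forms G P act \<theta> \<omega> k = {\<Omega> \<in> diff_forms P k.
     \<forall>U V \<Phi>. local_equivalence G P act \<theta> \<omega> U V \<Phi> \<longrightarrow>
       (\<forall>p\<in>U. \<forall>\<xi>s. length \<xi>s = k \<longrightarrow> \<Omega> (\<Phi> p) (map (tangent_map P P \<Phi> p) \<xi>s) = \<Omega> p \<xi>s)}"

text \<open>A 0-form is identified with a function through its value on the empty tuple.\<close>

definition invariants where
  "invariants G P act \<theta> \<omega> = (\<lambda>\<Omega> p. \<Omega> p []) ` invariant_forms G P act \<theta> \<omega> 0"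

definition invariant_rank where
  "invariant_rank G P act \<theta> \<omega> p = dim {differential P I p | I. I \<in> invariants G P act \<theta> \<omega>}"

definition fully_regular where
  "fully_regular G P act \<theta> \<omega> d \<longleftrightarrow> (\<forall>p\<in>pts P. invariant_rank G P act \<theta> \<omega> p = d)"

definition equivalence_rel where
  "equivalence_rel G P act \<theta> \<omega> =
     {(p, q). \<exists>U V \<Phi>. local_equivalence G P act \<theta> \<omega> U V \<Phi> \<and> p \<in> U \<and> \<Phi> p = q}"

definition classifying_map where
  "classifying_map G P act \<theta> \<omega> p = equivalence_rel G P act \<theta> \<omega> `` {p}"

text \<open>\<open>X\<close> is \<open>P/\<sim>\<close> with a \<open>d\<close>-dimensional smooth structure making the quotient map a
  submersion. A surjective submersion determines the topology and the smooth structure of its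
  target, so there is at most one such structure up to the choice of atlas and of the ambient
  \<open>model X\<close>.\<close>

definition classifying_manifold ::
    "(real^'n^'n) set \<Rightarrow> ('p, 'e::euclidean_space) mfd \<Rightarrow> ('p \<Rightarrow> real^'n^'n \<Rightarrow> 'p) \<Rightarrow>
     ('p \<Rightarrow> 'e \<Rightarrow> real^'n) \<Rightarrow> ('p \<Rightarrow> 'e \<Rightarrow> real^'n^'n) \<Rightarrow> nat \<Rightarrow> ('p set, 'e) mfd \<Rightarrow> bool" where
  "classifying_manifold G P act \<theta> \<omega> d X \<longleftrightarrow>
     pts X = pts P // equivalence_rel G P act \<theta> \<omega> \<and>
     smooth_manifold X \<and> dim (model X) = d \<and>
     smooth_map P (pts P) X (classifying_map G P act \<theta> \<omega>) \<and>
     (\<forall>p\<in>pts P. range (tangent_map P X (classifying_map G P act \<theta> \<omega>) p) = model X)"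

text \<open>The fibre \<open>\<real>\<^sup>n \<oplus> \<gg>\<close> of the trivial bundle \<open>A\<close>, and the map \<open>H : TP \<rightarrow> A\<close>.\<close>

definition coframe_fibre :: "(real^'n^'n) set \<Rightarrow> ((real^'n) \<times> (real^'n^'n)) set" where
  "coframe_fibre G = UNIV \<times> lie_algebra G"

definition coframe_map where
  "coframe_map G P act \<theta> \<omega> p \<xi> = (classifying_map G P act \<theta> \<omega> p, (\<theta> p \<xi>, \<omega> p \<xi>))"

text \<open>Pullback along a bundle map given by \<open>H p \<xi> = (h p, H\<^sub>p \<xi>)\<close>.\<close>

definition bundle_pullback ::
    "('p \<Rightarrow> 'x) \<Rightarrow> ('p \<Rightarrow> 'e \<Rightarrow> 'x \<times> 'v) \<Rightarrow> ('x \<Rightarrow> 'v list \<Rightarrow> real) \<Rightarrow> 'p \<Rightarrow> 'e list \<Rightarrow> real" where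
  "bundle_pullback h H \<eta> p \<xi>s = \<eta> (h p) (map (\<lambda>\<xi>. snd (H p \<xi>)) \<xi>s)"

end

theory Submission
  imports Defs
begin

text \<open>The proof rests on two facts about the coframe \<open>L\<^sub>p = (\<theta>\<^sub>p, \<omega>\<^sub>p)\<close>, the fibre part of \<open>H\<close>.

It is an isomorphism from the tangent space at \<open>p\<close> onto \<open>\<real>\<^sup>n \<oplus> \<gg>\<close>: it is onto because \<open>\<theta>\<^sub>p\<close> is, and
because fundamental vectors are killed by \<open>\<theta>\<^sub>p\<close> and reproduced by \<open>\<omega>\<^sub>p\<close>; injectivity follows by
counting dimensions (\<open>coframe_iso\<close>). Hence, at each point separately, a form on \<open>P\<close> is the same thing
as a form on \<open>\<real>\<^sup>n \<oplus> \<gg>\<close>, and the pullback along \<open>H\<close> is injective since \<open>h\<close> is onto.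

It is preserved by local equivalences. Written in this frame, the pullback condition
\<open>\<Phi>\<^sup>*\<Omega> = \<Omega>\<close> therefore says that the coefficients of \<open>\<Omega>\<close> agree at \<open>p\<close> and \<open>\<Phi> p\<close>. As local
equivalences are closed under inverses and composition (on the domain where the composite makes sense),
they generate nothing new: the fibres of \<open>h\<close> are exactly the sets of points related by a single local
equivalence (\<open>classifying_map_eq_iff\<close>). So \<open>\<Omega>\<close> is invariant iff its frame
coefficients are functions of \<open>h p\<close>.

What remains is smoothness. A form on \<open>P\<close> is smooth iff its values on frame
vectors are smooth functions; in one direction this is an expansion by multilinearity
(\<open>Ck_on_alternating_form_apply\<close>), in the other it also needs that the inverse of a smooth
family of linear isomorphisms is smooth (\<open>Ck_on_linear_system_solution\<close>). A function \<open>g\<close> on the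
classifying manifold is smooth as soon as \<open>g \<circ> h\<close> is, because the submersion \<open>h\<close> has smooth local
sections (\<open>smooth_fun_descends_along_submersion\<close>). The sections come from the inverse function theorem,
whose smooth version is obtained from the differentiable one by bootstrapping: the derivative of the
inverse solves a linear system whose coefficients are as smooth as the inverse itself.\<close>

section \<open>Calculus of continuously differentiable functions on open sets\<close>

lemma Ck_on_subset: "Ck_on k S f \<Longrightarrow> T \<subseteq> S \<Longrightarrow> Ck_on k T f"
  by (induction k arbitrary: f) (auto intro: continuous_on_subset)

lemma Ck_on_Suc_has_derivative:
  "Ck_on (Suc k) S f \<Longrightarrow> x \<in> S \<Longrightarrow> (f has_derivative frechet_derivative f (at x)) (at x)"
  by (simp add: frechet_derivative_works)

text \<open>The successor step of the recursion asks for differentiability and for \<open>C\<^sup>k\<close> directional derivatives,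
not for the function itself to be \<open>C\<^sup>k\<close>: continuity comes from differentiability at the bottom of the recursion.\<close>

lemma Ck_on_Suc_imp: "Ck_on (Suc k) S f \<Longrightarrow> Ck_on k S f"
proof (induction k arbitrary: f)
  case 0
  then show ?case
    by (auto intro!: continuous_at_imp_continuous_on differentiable_imp_continuous_within)
next
  case (Suc k)
  from Suc.prems have "\<forall>x\<in>S. f differentiable (at x)"
    and "\<And>v. Ck_on (Suc k) S (\<lambda>x. frechet_derivative f (at x) v)"
    by simp_all
  with Suc.IH show ?case by (simp del: Ck_on.simps(2) add: Ck_on.simps(2)[of k S f])
qed

lemma Ck_on_imp_continuous_on: "Ck_on k S f \<Longrightarrow> continuous_on S f"
proof (induction k arbitrary: f)
  case (Suc k)
  then show ?case using Ck_on_Suc_imp by blast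
qed simp

text \<open>The set must be open because the derivatives in \<open>Ck_on\<close> are taken in the ambient space,
so that they depend on the values near a point and not only on those in the set.\<close>

lemma Ck_on_cong:
  assumes "open S" "Ck_on k S f" "\<And>x. x \<in> S \<Longrightarrow> f x = g x"
  shows "Ck_on k S g"
  using assms(2,3)
proof (induction k arbitrary: f g)
  case 0
  then show ?case by (simp cong: continuous_on_cong)
next
  case (Suc k)
  have der: "(g has_derivative frechet_derivative f (at x)) (at x)" if "x \<in> S" for x
    using has_derivative_transform_within_open[OF Ck_on_Suc_has_derivative[OF Suc.prems(1) that]
        assms(1) that Suc.prems(2)] .
  have eq: "frechet_derivative g (at x) = frechet_derivative f (at x)" if "x \<in> S" for x
    using frechet_derivative_at[OF der[OF that]] by (rule sym)
  have "Ck_on k S (\<lambda>x. frechet_derivative g (at x) v)" for v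
  proof (rule Suc.IH)
    show "Ck_on k S (\<lambda>x. frechet_derivative f (at x) v)" using Suc.prems(1) by simp
  qed (simp add: eq)
  with der show ?case by (auto simp: differentiable_def)
qed

lemma Ck_on_SucI:
  assumes "open S" "\<And>x. x \<in> S \<Longrightarrow> (f has_derivative f' x) (at x)"
    and "\<And>v. Ck_on k S (\<lambda>x. f' x v)"
  shows "Ck_on (Suc k) S f"
proof -
  have "f' x v = frechet_derivative f (at x) v" if "x \<in> S" for x v
    using frechet_derivative_at[OF assms(2)[OF that]] by simp
  then have "Ck_on k S (\<lambda>x. frechet_derivative f (at x) v)" for v
    by (rule Ck_on_cong[OF assms(1) assms(3)])
  with assms(2) show ?thesis by (auto simp: differentiable_def)
qed

lemma Ck_on_const: "Ck_on k S (\<lambda>x. c)"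
  by (induction k arbitrary: c) (auto simp: frechet_derivative_const)

lemma Ck_on_bounded_linear:
  assumes "open S" "bounded_linear L" "Ck_on k S f"
  shows "Ck_on k S (\<lambda>x. L (f x))"
  using assms(3)
proof (induction k arbitrary: f)
  case 0
  then show ?case using bounded_linear.continuous_on[OF assms(2)] by simp
next
  case (Suc k)
  show ?case
  proof (rule Ck_on_SucI[OF assms(1)])
    show "((\<lambda>x. L (f x)) has_derivative (\<lambda>v. L (frechet_derivative f (at x) v))) (at x)"
      if "x \<in> S" for x
      by (rule bounded_linear.has_derivative[OF assms(2) Ck_on_Suc_has_derivative[OF Suc.prems that]])
    show "Ck_on k S (\<lambda>x. L (frechet_derivative f (at x) v))" for v
      using Suc.prems by (intro Suc.IH) simp
  qed
qed

lemma Ck_on_id: "open S \<Longrightarrow> Ck_on k S (\<lambda>x. x)"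
proof (induction k)
  case (Suc k)
  show ?case
    by (rule Ck_on_SucI[OF Suc.prems, where f' = "\<lambda>x v. v"]) (auto intro: Ck_on_const)
qed simp

lemma Ck_on_linear:
  fixes L :: "'a::euclidean_space \<Rightarrow> 'b::real_normed_vector"
  assumes "open S" "linear L"
  shows "Ck_on k S L"
  using Ck_on_bounded_linear[OF assms(1) _ Ck_on_id[OF assms(1)]] assms(2)
  by (simp add: linear_conv_bounded_linear)

lemma Ck_on_add:
  assumes "open S" "Ck_on k S f" "Ck_on k S g"
  shows "Ck_on k S (\<lambda>x. f x + g x)"
  using assms(2,3)
proof (induction k arbitrary: f g)
  case (Suc k)
  show ?case
  proof (rule Ck_on_SucI[OF assms(1)])
    show "((\<lambda>x. f x + g x) has_derivative
        (\<lambda>v. frechet_derivative f (at x) v + frechet_derivative g (at x) v)) (at x)" if "x \<in> S" for x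
      by (rule has_derivative_add[OF Suc.prems[THEN Ck_on_Suc_has_derivative, OF that]])
    show "Ck_on k S (\<lambda>x. frechet_derivative f (at x) v + frechet_derivative g (at x) v)" for v
      using Suc.prems by (intro Suc.IH) simp_all
  qed
qed (simp add: continuous_on_add)

lemma Ck_on_diff:
  assumes "open S" "Ck_on k S f" "Ck_on k S g"
  shows "Ck_on k S (\<lambda>x. f x - g x)"
  using Ck_on_add[OF assms(1,2) Ck_on_bounded_linear[OF assms(1) bounded_linear_minus[OF bounded_linear_ident] assms(3)]]
  by simp

lemma Ck_on_sum:
  assumes "open S" "\<And>i. i \<in> I \<Longrightarrow> Ck_on k S (f i)"
  shows "Ck_on k S (\<lambda>x. \<Sum>i\<in>I. f i x)"
  using assms(2) by (induction I rule: infinite_finite_induct) (auto intro: Ck_on_const Ck_on_add assms(1))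

lemma Ck_on_scaleR:
  fixes f :: "'a::euclidean_space \<Rightarrow> real"
  assumes "open S" "Ck_on k S f" "Ck_on k S g"
  shows "Ck_on k S (\<lambda>x. f x *\<^sub>R g x)"
  using assms(2,3)
proof (induction k arbitrary: f g)
  case (Suc k)
  show ?case
  proof (rule Ck_on_SucI[OF assms(1)])
    show "((\<lambda>x. f x *\<^sub>R g x) has_derivative
        (\<lambda>v. f x *\<^sub>R frechet_derivative g (at x) v + frechet_derivative f (at x) v *\<^sub>R g x)) (at x)"
      if "x \<in> S" for x
      by (rule has_derivative_scaleR[OF Suc.prems[THEN Ck_on_Suc_has_derivative, OF that]])
    show "Ck_on k S (\<lambda>x. f x *\<^sub>R frechet_derivative g (at x) v + frechet_derivative f (at x) v *\<^sub>R g x)" for v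
      using Suc.prems Ck_on_Suc_imp[OF Suc.prems(1)] Ck_on_Suc_imp[OF Suc.prems(2)]
      by (intro Ck_on_add[OF assms(1)] Suc.IH) simp_all
  qed
qed (simp add: continuous_on_scaleR)

lemma linear_expand_Basis:
  assumes "linear f"
  shows "f (x::'a::euclidean_space) = (\<Sum>b\<in>Basis. (x \<bullet> b) *\<^sub>R f b)"
proof -
  have "f x = f (\<Sum>b\<in>Basis. (x \<bullet> b) *\<^sub>R b)" by (simp add: euclidean_representation)
  then show ?thesis using assms by (simp add: linear_sum linear_scale)
qed

text \<open>The product rule in the form that the chain rule needs, where a point-dependent linear map is
applied to a point-dependent vector.\<close>

lemma Ck_on_linear_family_apply:
  fixes A :: "'a::euclidean_space \<Rightarrow> 'b::euclidean_space \<Rightarrow> 'c::real_normed_vector"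
  assumes "open S" "\<And>x. x \<in> S \<Longrightarrow> linear (A x)"
    and "\<And>b. Ck_on k S (\<lambda>x. A x b)" "Ck_on k S f"
  shows "Ck_on k S (\<lambda>x. A x (f x))"
proof (rule Ck_on_cong[OF assms(1)])
  show "Ck_on k S (\<lambda>x. \<Sum>b\<in>Basis. (f x \<bullet> b) *\<^sub>R A x b)"
    by (rule Ck_on_sum[OF assms(1)]) (rule Ck_on_scaleR[OF assms(1)
        Ck_on_bounded_linear[OF assms(1) bounded_linear_inner_left assms(4)] assms(3)])
  show "(\<Sum>b\<in>Basis. (f x \<bullet> b) *\<^sub>R A x b) = A x (f x)" if "x \<in> S" for x
    by (rule linear_expand_Basis[OF assms(2)[OF that], symmetric])
qed

text \<open>Induction on the order, for all \<open>g\<close> at once: the directional derivative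
\<open>g'(f x)(f'(x) v)\<close> is a linear family applied to a vector, and the family consists of directional
derivatives of \<open>g\<close> composed with \<open>f\<close>, one order lower.\<close>

lemma Ck_on_compose:
  fixes f :: "'a::euclidean_space \<Rightarrow> 'b::euclidean_space"
  assumes "open S" "open T" "Ck_on k S f" "Ck_on k T g" "f ` S \<subseteq> T"
  shows "Ck_on k S (\<lambda>x. g (f x))"
  using assms(3,4)
proof (induction k arbitrary: g)
  case 0
  then have "continuous_on S f" "continuous_on T g" by simp_all
  then have "continuous_on S (\<lambda>x. g (f x))"
    using continuous_on_compose2[OF _ _ assms(5)] by blast
  then show ?case by simp
next
  case (Suc k)
  have der: "(g has_derivative frechet_derivative g (at (f x))) (at (f x))" if "x \<in> S" for x
  proof (rule Ck_on_Suc_has_derivative[OF Suc.prems(2)])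
    show "f x \<in> T" using that assms(5) by blast
  qed
  show ?case
  proof (rule Ck_on_SucI[OF assms(1)])
    show "((\<lambda>x. g (f x)) has_derivative
        (\<lambda>v. frechet_derivative g (at (f x)) (frechet_derivative f (at x) v))) (at x)" if "x \<in> S" for x
      by (rule has_derivative_compose[OF Ck_on_Suc_has_derivative[OF Suc.prems(1) that] der[OF that]])
    show "Ck_on k S (\<lambda>x. frechet_derivative g (at (f x)) (frechet_derivative f (at x) v))" for v
    proof (rule Ck_on_linear_family_apply[OF assms(1),
          where A = "\<lambda>x. frechet_derivative g (at (f x))"])
      show "linear (frechet_derivative g (at (f x)))" if "x \<in> S" for x
        by (rule has_derivative_linear[OF der[OF that]])
      show "Ck_on k S (\<lambda>x. frechet_derivative g (at (f x)) b)" for b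
        using Suc.IH[OF Ck_on_Suc_imp[OF Suc.prems(1)], of "\<lambda>y. frechet_derivative g (at y) b"]
          Suc.prems(2) by simp
      show "Ck_on k S (\<lambda>x. frechet_derivative f (at x) v)"
        using Suc.prems(1) by simp
    qed
  qed
qed

lemma Ck_on_local:
  assumes "\<And>x. x \<in> S \<Longrightarrow> \<exists>W. open W \<and> x \<in> W \<and> Ck_on k W f"
  shows "Ck_on k S f"
  using assms
proof (induction k arbitrary: f)
  case 0
  have "isCont f x" if "x \<in> S" for x
    using "0"[OF that] by (auto simp: continuous_on_eq_continuous_at)
  then show ?case by (simp add: continuous_at_imp_continuous_on)
next
  case (Suc k)
  have "f differentiable (at x)" if "x \<in> S" for x
    using Suc.prems[OF that] by auto
  moreover have "Ck_on k S (\<lambda>x. frechet_derivative f (at x) v)" for v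
  proof (rule Suc.IH)
    fix x assume "x \<in> S"
    from Suc.prems[OF this] obtain W where "open W" "x \<in> W" "Ck_on (Suc k) W f" by blast
    then show "\<exists>W. open W \<and> x \<in> W \<and> Ck_on k W (\<lambda>x. frechet_derivative f (at x) v)"
      by auto
  qed
  ultimately show ?case by simp
qed

lemma smooth_on_openI: "open S \<Longrightarrow> (\<And>k. Ck_on k S f) \<Longrightarrow> smooth_on S f"
  unfolding smooth_on_def by blast

text \<open>On an open set the local extensions in \<open>smooth_on\<close> agree with the function near each point,
so they can be dropped. This is what makes derivatives available.\<close>

lemma smooth_on_imp_Ck_on:
  assumes "open S" "smooth_on S f"
  shows "Ck_on k S f"
proof (rule Ck_on_local)
  fix x assume "x \<in> S"
  then obtain W F where W: "open W" "x \<in> W" "\<And>k. Ck_on k W F" "\<And>y. y \<in> S \<inter> W \<Longrightarrow> F y = f y"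
    using assms(2) unfolding smooth_on_def by meson
  have "Ck_on k (S \<inter> W) f"
    using W assms(1) by (intro Ck_on_cong[OF _ Ck_on_subset[OF W(3)]]) auto
  then show "\<exists>W. open W \<and> x \<in> W \<and> Ck_on k W f"
    using W assms(1) \<open>x \<in> S\<close> by (intro exI[of _ "S \<inter> W"]) auto
qed

lemma smooth_on_subset:
  assumes "smooth_on S f" "T \<subseteq> S"
  shows "smooth_on T f"
  unfolding smooth_on_def
proof
  fix x assume "x \<in> T"
  then obtain W F where "open W" "x \<in> W" "\<forall>k. Ck_on k W F" "\<And>y. y \<in> S \<inter> W \<Longrightarrow> F y = f y"
    using assms unfolding smooth_on_def by (meson subsetD)
  then show "\<exists>W F. open W \<and> x \<in> W \<and> (\<forall>k. Ck_on k W F) \<and> (\<forall>y\<in>T \<inter> W. F y = f y)"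
    using assms(2) by (intro exI[of _ W] exI[of _ F]) auto
qed

lemma smooth_on_cong:
  assumes "smooth_on S f" "\<And>x. x \<in> S \<Longrightarrow> f x = g x"
  shows "smooth_on S g"
  using assms(1) unfolding smooth_on_def by (simp add: assms(2) cong: conj_cong)

lemma smooth_on_local:
  assumes "\<And>x. x \<in> S \<Longrightarrow> \<exists>T. openin (top_of_set S) T \<and> x \<in> T \<and> smooth_on T f"
  shows "smooth_on S f"
  unfolding smooth_on_def
proof
  fix x assume "x \<in> S"
  then obtain T where T: "openin (top_of_set S) T" "x \<in> T" "smooth_on T f"
    using assms by blast
  then obtain T' where T': "open T'" "T = S \<inter> T'" by (auto simp: openin_open)
  obtain W F where W: "open W" "x \<in> W" "\<forall>k. Ck_on k W F" "\<And>y. y \<in> T \<inter> W \<Longrightarrow> F y = f y"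
    using T(2,3) unfolding smooth_on_def by meson
  then show "\<exists>W F. open W \<and> x \<in> W \<and> (\<forall>k. Ck_on k W F) \<and> (\<forall>y\<in>S \<inter> W. F y = f y)"
    using T T' by (intro exI[of _ "W \<inter> T'"] exI[of _ F]) (auto intro: Ck_on_subset)
qed

lemma smooth_on_compose:
  fixes f :: "'a::euclidean_space \<Rightarrow> 'b::euclidean_space"
  assumes "smooth_on S f" "smooth_on T g" "f ` S \<subseteq> T"
  shows "smooth_on S (\<lambda>x. g (f x))"
  unfolding smooth_on_def
proof
  fix x assume x: "x \<in> S"
  then obtain W F where W: "open W" "x \<in> W" "\<And>k. Ck_on k W F" "\<And>y. y \<in> S \<inter> W \<Longrightarrow> F y = f y"
    using assms(1) unfolding smooth_on_def by meson
  have "f x \<in> T" using assms(3) x by blast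
  then obtain Y E where Y: "open Y" "f x \<in> Y" "\<And>k. Ck_on k Y E" "\<And>y. y \<in> T \<inter> Y \<Longrightarrow> E y = g y"
    using assms(2) unfolding smooth_on_def by meson
  let ?W = "W \<inter> F -` Y"
  have "open ?W"
    using continuous_open_preimage[OF Ck_on_imp_continuous_on[OF W(3)] W(1) Y(1)] by simp
  moreover have "x \<in> ?W" using W(2) W(4)[of x] x Y(2) by simp
  moreover have "Ck_on k ?W (\<lambda>x. E (F x))" for k
    using \<open>open ?W\<close> Y by (intro Ck_on_compose[OF _ Y(1) Ck_on_subset[OF W(3)] Y(3)]) auto
  moreover have "E (F y) = g (f y)" if "y \<in> S \<inter> ?W" for y
  proof -
    have "F y = f y" using W(4) that by blast
    then show ?thesis using Y(4)[of "f y"] that assms(3) by auto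
  qed
  ultimately show "\<exists>W F. open W \<and> x \<in> W \<and> (\<forall>k. Ck_on k W F) \<and> (\<forall>y\<in>S \<inter> W. F y = g (f y))"
    by blast
qed

section \<open>Smooth dependence of solutions of linear systems\<close>

text \<open>A product rule in which one factor is merely continuous, which suffices where the other factor
vanishes.\<close>

lemma has_derivative_scaleR_vanishing:
  fixes c :: "'a::real_normed_vector \<Rightarrow> real"
  assumes "isCont c x0" "(f has_derivative f') (at x0)" "f x0 = 0"
  shows "((\<lambda>x. c x *\<^sub>R f x) has_derivative (\<lambda>u. c x0 *\<^sub>R f' u)) (at x0)"
proof -
  interpret f': bounded_linear f' using assms(2) by (rule has_derivative_bounded_linear)
  have *: "((\<lambda>x. (f x - f' (x - x0)) /\<^sub>R norm (x - x0)) \<longlongrightarrow> 0) (at x0)"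
    using assms(2,3) by (simp add: has_derivative_at_within divide_inverse diff_diff_eq)
  have cx: "(c \<longlongrightarrow> c x0) (at x0)" using assms(1) by (simp add: isCont_def)
  obtain K where K: "K > 0" "\<And>u. norm (f' u) \<le> norm u * K" using f'.pos_bounded by blast
  have **: "((\<lambda>x. (c x - c x0) *\<^sub>R (f' (x - x0) /\<^sub>R norm (x - x0))) \<longlongrightarrow> 0) (at x0)"
  proof (rule tendsto_norm_zero_cancel, rule tendsto_sandwich[OF _ _ tendsto_const])
    show "((\<lambda>x. \<bar>c x - c x0\<bar> * K) \<longlongrightarrow> 0) (at x0)"
      using tendsto_mult_right_zero[OF tendsto_rabs_zero[OF LIM_zero[OF cx]], of K]
      by (simp add: mult.commute)
    have "norm (f' u /\<^sub>R norm u) \<le> K" for u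
      using K by (cases "u = 0") (auto simp: f'.zero field_simps)
    then show "\<forall>\<^sub>F x in at x0. norm ((c x - c x0) *\<^sub>R (f' (x - x0) /\<^sub>R norm (x - x0))) \<le> \<bar>c x - c x0\<bar> * K"
      unfolding norm_scaleR[of "c _ - c x0"] real_norm_def by (intro always_eventually allI mult_left_mono) auto
  qed auto
  have "((\<lambda>x. c x *\<^sub>R ((f x - f' (x - x0)) /\<^sub>R norm (x - x0))
      + (c x - c x0) *\<^sub>R (f' (x - x0) /\<^sub>R norm (x - x0))) \<longlongrightarrow> 0) (at x0)"
    using tendsto_add[OF tendsto_scaleR[OF cx *] **] by simp
  then have "((\<lambda>x. (c x *\<^sub>R f x - c x0 *\<^sub>R f x0 - c x0 *\<^sub>R f' (x - x0)) /\<^sub>R norm (x - x0)) \<longlongrightarrow> 0) (at x0)"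
    by (rule Lim_transform_eventually) (simp add: assms(3) algebra_simps)
  moreover have "bounded_linear (\<lambda>u. c x0 *\<^sub>R f' u)"
    by (rule bounded_linear_const_scaleR[OF f'.bounded_linear_axioms])
  ultimately show ?thesis
    by (simp add: has_derivative_at_within diff_diff_eq divide_inverse)
qed

text \<open>An injective linear map satisfies \<open>m \<parallel>z\<parallel> \<le> \<parallel>A z\<parallel>\<close> for some \<open>m > 0\<close>, and by continuity the
bound holds near the point with \<open>m/2\<close>. Applied to \<open>c x - c x0\<close>, it controls the change of the
solution by the residual \<open>v x - A x (c x0)\<close>, which tends to 0.\<close>

lemma linear_system_solution_continuous:
  fixes A :: "'a::euclidean_space \<Rightarrow> 'b::euclidean_space \<Rightarrow> 'c::euclidean_space"
  assumes "open S" and lin: "\<And>x. x \<in> S \<Longrightarrow> linear (A x)" and inj: "\<And>x. x \<in> S \<Longrightarrow> inj (A x)"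
    and A: "\<And>b. continuous_on S (\<lambda>x. A x b)" and v: "continuous_on S v"
    and c: "\<And>x. x \<in> S \<Longrightarrow> A x (c x) = v x"
  shows "continuous_on S c"
proof (rule continuous_at_imp_continuous_on, rule ballI)
  fix x0 assume x0: "x0 \<in> S"
  have ev: "\<forall>\<^sub>F x in at x0. x \<in> S" by (rule eventually_at_in_open'[OF assms(1) x0])
  have tA: "((\<lambda>x. A x b) \<longlongrightarrow> A x0 b) (at x0)" for b
    using A assms(1) x0 by (simp add: continuous_on_eq_continuous_at isCont_def)
  have tv: "(v \<longlongrightarrow> v x0) (at x0)"
    using v assms(1) x0 by (simp add: continuous_on_eq_continuous_at isCont_def)
  obtain m where m: "m > 0" "\<And>z. m * norm z \<le> norm (A x0 z)"
    using linear_inj_bounded_below_pos[OF lin[OF x0] inj[OF x0]] by blast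
  have "((\<lambda>x. \<Sum>b\<in>Basis. norm (A x b - A x0 b)) \<longlongrightarrow> (\<Sum>b\<in>(Basis::'b set). 0)) (at x0)"
    by (intro tendsto_sum tendsto_norm_zero LIM_zero tA)
  \<comment> \<open>On basis vectors \<open>A x\<close> is close to \<open>A x0\<close>, hence also in operator norm.\<close>
  then have "\<forall>\<^sub>F x in at x0. (\<Sum>b\<in>Basis. norm (A x b - A x0 b)) < m / 2"
    using m(1) by (intro order_tendstoD(2)) auto
  with ev have below: "\<forall>\<^sub>F x in at x0. \<forall>z. m / 2 * norm z \<le> norm (A x z)"
  proof eventually_elim
    case (elim x)
    show ?case
    proof
      fix z
      have "A x0 z - A x z = (\<Sum>b\<in>Basis. (z \<bullet> b) *\<^sub>R (A x0 b - A x b))"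
        using linear_expand_Basis[OF lin[OF x0], of z] linear_expand_Basis[OF lin[OF elim(1)], of z]
        by (simp add: scaleR_diff_right sum_subtractf)
      also have "norm \<dots> \<le> (\<Sum>b\<in>Basis. norm z * norm (A x b - A x0 b))"
        by (intro sum_norm_le) (auto simp: norm_minus_commute Basis_le_norm intro!: mult_right_mono)
      also have "\<dots> = norm z * (\<Sum>b\<in>Basis. norm (A x b - A x0 b))" by (simp add: sum_distrib_left)
      also have "\<dots> \<le> norm z * (m / 2)" using elim(2) by (intro mult_left_mono) auto
      finally have "norm (A x0 z - A x z) \<le> norm z * (m / 2)" .
      moreover have "norm (A x0 z) \<le> norm (A x0 z - A x z) + norm (A x z)"
        by (metis norm_triangle_sub add.commute)
      ultimately show "m / 2 * norm z \<le> norm (A x z)" using m(2)[of z] by (simp add: algebra_simps)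
    qed
  qed
  have "((\<lambda>x. norm (v x - A x (c x0)) * (2 / m)) \<longlongrightarrow> 0) (at x0)"
    using tendsto_diff[OF tv tA[of "c x0"]] c[OF x0]
    by (intro tendsto_mult_left_zero tendsto_norm_zero) simp
  then have "((\<lambda>x. c x - c x0) \<longlongrightarrow> 0) (at x0)"
  proof (rule Lim_null_comparison[rotated])
    show "\<forall>\<^sub>F x in at x0. norm (c x - c x0) \<le> norm (v x - A x (c x0)) * (2 / m)"
      using ev below
    proof eventually_elim
      case (elim x)
      have "m / 2 * norm (c x - c x0) \<le> norm (A x (c x - c x0))" using elim(2) by blast
      also have "A x (c x - c x0) = v x - A x (c x0)"
        using lin[OF elim(1)] c[OF elim(1)] by (simp add: linear_diff)
      finally show ?case using m(1) by (simp add: field_simps)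
    qed
  qed
  then show "isCont c x0" by (simp add: isCont_def LIM_zero_iff)
qed

text \<open>With a left inverse \<open>L\<close> of \<open>A x0\<close>, the equation \<open>A x (c x) = v x\<close> can be rewritten as
\<open>c x = c x0 + L (v x - v x0 + (A x0 - A x) (c x))\<close>. On the right the solution occurs only as a
factor of something that vanishes at \<open>x0\<close>, so its continuity is enough to differentiate.\<close>

lemma linear_system_solution_differentiable:
  fixes A :: "'a::euclidean_space \<Rightarrow> 'b::euclidean_space \<Rightarrow> 'c::euclidean_space"
  assumes "open S" and lin: "\<And>x. x \<in> S \<Longrightarrow> linear (A x)" and inj: "\<And>x. x \<in> S \<Longrightarrow> inj (A x)"
    and A: "\<And>b x. x \<in> S \<Longrightarrow> (\<lambda>x. A x b) differentiable (at x)"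
    and v: "\<And>x. x \<in> S \<Longrightarrow> v differentiable (at x)"
    and c: "\<And>x. x \<in> S \<Longrightarrow> A x (c x) = v x"
    and x0: "x0 \<in> S"
  shows "c differentiable (at x0)"
proof -
  have "continuous_on S (\<lambda>x. A x b)" for b
    using A by (auto intro!: continuous_at_imp_continuous_on differentiable_imp_continuous_within)
  moreover have "continuous_on S v"
    using v by (auto intro!: continuous_at_imp_continuous_on differentiable_imp_continuous_within)
  ultimately have "continuous_on S c"
    by (intro linear_system_solution_continuous[OF assms(1) lin inj _ _ c])
  then have cont: "isCont c x0" using assms(1) x0 by (simp add: continuous_on_eq_continuous_at)
  obtain L where L: "linear L" "L \<circ> A x0 = id"
    using linear_injective_left_inverse[OF lin[OF x0] inj[OF x0]] by blast
  then have bL: "bounded_linear L" by (simp add: linear_conv_bounded_linear)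
  let ?e = "\<lambda>x. c x0 + L ((v x - v x0) + (\<Sum>b\<in>Basis. (c x \<bullet> b) *\<^sub>R (A x0 b - A x b)))"
  have eq: "?e x = c x" if "x \<in> S" for x
  proof -
    have "(\<Sum>b\<in>Basis. (c x \<bullet> b) *\<^sub>R (A x0 b - A x b)) = A x0 (c x) - A x (c x)"
      using linear_expand_Basis[OF lin[OF x0], of "c x"] linear_expand_Basis[OF lin[OF that], of "c x"]
      by (simp add: scaleR_diff_right sum_subtractf)
    then have "?e x = c x0 + L (A x0 (c x - c x0))"
      using c[OF x0] c[OF that] lin[OF x0] by (simp add: linear_diff)
    also have "L (A x0 (c x - c x0)) = c x - c x0" using fun_cong[OF L(2), of "c x - c x0"] by simp
    finally show ?thesis by simp
  qed
  have "(\<lambda>x. (c x \<bullet> b) *\<^sub>R (A x0 b - A x b)) differentiable (at x0)" for b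
  proof -
    obtain A' where "((\<lambda>x. A x b) has_derivative A') (at x0)"
      using A[OF x0] by (auto simp: differentiable_def)
    then have "((\<lambda>x. A x0 b - A x b) has_derivative (\<lambda>u. 0 - A' u)) (at x0)"
      by (intro has_derivative_diff has_derivative_const)
    moreover have "isCont (\<lambda>x. c x \<bullet> b) x0" by (intro continuous_intros cont)
    ultimately have "((\<lambda>x. (c x \<bullet> b) *\<^sub>R (A x0 b - A x b)) has_derivative
        (\<lambda>u. (c x0 \<bullet> b) *\<^sub>R (0 - A' u))) (at x0)"
      by (intro has_derivative_scaleR_vanishing) auto
    then show ?thesis by (auto simp: differentiable_def)
  qed
  then have "(\<lambda>x. (v x - v x0) + (\<Sum>b\<in>Basis. (c x \<bullet> b) *\<^sub>R (A x0 b - A x b))) differentiable (at x0)"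
    by (intro differentiable_add differentiable_diff differentiable_sum v x0 finite_Basis) auto
  then obtain D where "((\<lambda>x. (v x - v x0) + (\<Sum>b\<in>Basis. (c x \<bullet> b) *\<^sub>R (A x0 b - A x b))) has_derivative D) (at x0)"
    by (auto simp: differentiable_def)
  then have "(?e has_derivative (\<lambda>u. 0 + L (D u))) (at x0)"
    by (intro has_derivative_add has_derivative_const bounded_linear.has_derivative[OF bL])
  then have "(c has_derivative (\<lambda>u. 0 + L (D u))) (at x0)"
    by (rule has_derivative_transform_within_open[OF _ assms(1) x0 eq])
  then show ?thesis by (auto simp: differentiable_def)
qed

text \<open>Smooth inversion of linear maps without determinants. Differentiating \<open>A c = v\<close> gives the system
\<open>A c' = v' - A' c\<close> for the derivative of the solution. It has the same matrix and a right-hand side that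
is one order less smooth, so induction on the order applies; this is why the right-hand side has
to vary with the point. The maps need only be injective, which allows different dimensions.\<close>

lemma Ck_on_linear_system_solution:
  fixes A :: "'a::euclidean_space \<Rightarrow> 'b::euclidean_space \<Rightarrow> 'c::euclidean_space"
  assumes "open S" and lin: "\<And>x. x \<in> S \<Longrightarrow> linear (A x)" and inj: "\<And>x. x \<in> S \<Longrightarrow> inj (A x)"
    and A: "\<And>b. Ck_on k S (\<lambda>x. A x b)" and v: "Ck_on k S v"
    and c: "\<And>x. x \<in> S \<Longrightarrow> A x (c x) = v x"
  shows "Ck_on k S c"
  using A v c
proof (induction k arbitrary: v c)
  case 0
  then show ?case using linear_system_solution_continuous[OF assms(1) lin inj, where v = v and c = c] by simp
next
  case (Suc k)
  have Ak: "Ck_on k S (\<lambda>x. A x b)" for b by (rule Ck_on_Suc_imp[OF Suc.prems(1)])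
  have ck: "Ck_on k S c"
    by (rule Suc.IH[OF Ak Ck_on_Suc_imp[OF Suc.prems(2)] Suc.prems(3)])
  have diff: "c differentiable (at x)" if "x \<in> S" for x
    by (rule linear_system_solution_differentiable[OF assms(1) lin inj _ _ Suc.prems(3) that])
       (use Suc.prems(1,2) in auto)
  define c' where "c' x = frechet_derivative c (at x)" for x
  define A' where "A' x u b = frechet_derivative (\<lambda>x. A x b) (at x) u" for x u b
  define v' where "v' x = frechet_derivative v (at x)" for x
  have dc: "(c has_derivative c' x) (at x)" if "x \<in> S" for x
    using diff[OF that] by (simp add: c'_def frechet_derivative_works)
  have dA: "((\<lambda>x. A x b) has_derivative (\<lambda>u. A' x u b)) (at x)" if "x \<in> S" for x b
    using Ck_on_Suc_has_derivative[OF Suc.prems(1) that] by (simp add: A'_def)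
  have dv: "(v has_derivative v' x) (at x)" if "x \<in> S" for x
    using Ck_on_Suc_has_derivative[OF Suc.prems(2) that] by (simp add: v'_def)
  have sol: "A x (c' x u) = v' x u - (\<Sum>b\<in>Basis. (c x \<bullet> b) *\<^sub>R A' x u b)" if "x \<in> S" for x u
  proof -
    have "((\<lambda>x. \<Sum>b\<in>Basis. (c x \<bullet> b) *\<^sub>R A x b) has_derivative
        (\<lambda>u. \<Sum>b\<in>Basis. (c x \<bullet> b) *\<^sub>R A' x u b + (c' x u \<bullet> b) *\<^sub>R A x b)) (at x)"
      by (intro has_derivative_sum has_derivative_scaleR dA that has_derivative_inner_left dc)
    then have "(v has_derivative
        (\<lambda>u. \<Sum>b\<in>Basis. (c x \<bullet> b) *\<^sub>R A' x u b + (c' x u \<bullet> b) *\<^sub>R A x b)) (at x)"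
    proof (rule has_derivative_transform_within_open[OF _ assms(1) that])
      show "(\<Sum>b\<in>Basis. (c y \<bullet> b) *\<^sub>R A y b) = v y" if "y \<in> S" for y
        using linear_expand_Basis[OF lin[OF that], of "c y"] Suc.prems(3)[OF that] by simp
    qed
    then have "v' x = (\<lambda>u. \<Sum>b\<in>Basis. (c x \<bullet> b) *\<^sub>R A' x u b + (c' x u \<bullet> b) *\<^sub>R A x b)"
      by (rule has_derivative_unique[OF dv[OF that]])
    then have "v' x u = (\<Sum>b\<in>Basis. (c x \<bullet> b) *\<^sub>R A' x u b) + (\<Sum>b\<in>Basis. (c' x u \<bullet> b) *\<^sub>R A x b)"
      by (simp add: sum.distrib)
    then show ?thesis using linear_expand_Basis[OF lin[OF that], of "c' x u"] by simp
  qed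
  show ?case
  proof (rule Ck_on_SucI[OF assms(1) dc])
    fix u
    have A'k: "Ck_on k S (\<lambda>x. A' x u b)" for b using Suc.prems(1)[of b] by (simp add: A'_def)
    have "Ck_on k S (\<lambda>x. c x \<bullet> b)" for b
      by (rule Ck_on_bounded_linear[OF assms(1) bounded_linear_inner_left ck])
    then have "Ck_on k S (\<lambda>x. \<Sum>b\<in>Basis. (c x \<bullet> b) *\<^sub>R A' x u b)"
      by (intro Ck_on_sum[OF assms(1)] Ck_on_scaleR[OF assms(1)] A'k)
    moreover have "Ck_on k S (\<lambda>x. v' x u)" using Suc.prems(2) by (simp add: v'_def)
    ultimately show "Ck_on k S (\<lambda>x. c' x u)"
      by (intro Suc.IH[OF Ak _ sol] Ck_on_diff[OF assms(1)])
  qed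
qed

section \<open>Local sections of submersions\<close>

text \<open>The derivative at \<open>x0\<close> is normalised to be the identity. The inverse is \<open>C\<^sup>k\<close> for all \<open>k\<close> by induction: its derivative at \<open>y\<close> in direction \<open>v\<close> is the solution of
\<open>f'(g y) w = v\<close>, and the coefficients \<open>f'(g y)\<close> are \<open>C\<^sup>k\<close> if \<open>g\<close> is.\<close>

lemma smooth_inverse_function:
  fixes f :: "'a::euclidean_space \<Rightarrow> 'a"
  assumes "open U" "\<And>k. Ck_on k U f" "x0 \<in> U" "(f has_derivative (\<lambda>u. u)) (at x0)"
  obtains V g where "open V" "f x0 \<in> V" "\<And>k. Ck_on k V g" "\<And>y. y \<in> V \<Longrightarrow> g y \<in> U \<and> f (g y) = y"
    "g (f x0) = x0"
proof -
  define f' where "f' x = Blinfun (frechet_derivative f (at x))" for x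
  have der: "(f has_derivative frechet_derivative f (at x)) (at x)" if "x \<in> U" for x
    using Ck_on_Suc_has_derivative[OF assms(2) that] .
  have app: "blinfun_apply (f' x) = frechet_derivative f (at x)" if "x \<in> U" for x
    unfolding f'_def using has_derivative_bounded_linear[OF der[OF that]]
    by (rule bounded_linear_Blinfun_apply)
  have d: "(f has_derivative blinfun_apply (f' x)) (at x)" if "x \<in> U" for x
    using der[OF that] app[OF that] by simp
  have "continuous_on U (\<lambda>x. blinfun_apply (f' x) i)" for i
  proof -
    have "Ck_on 0 U (\<lambda>x. frechet_derivative f (at x) i)"
      using assms(2)[of "Suc 0"] by simp
    then show ?thesis using app by (simp cong: continuous_on_cong)
  qed
  then have cont: "continuous_on U f'" by (intro continuous_on_blinfun_componentwise)
  have "blinfun_apply (f' x0) = (\<lambda>u. u)"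
    using has_derivative_unique[OF d[OF assms(3)] assms(4)] .
  then have inv: "id_blinfun o\<^sub>L f' x0 = id_blinfun" by (intro blinfun_eqI) simp
  obtain U' V g g' where *: "open U'" "U' \<subseteq> U" "x0 \<in> U'" "open V" "f x0 \<in> V" "homeomorphism U' V f g"
    "\<And>y. y \<in> V \<Longrightarrow> (g has_derivative (g' y)) (at y)"
    "\<And>y. y \<in> V \<Longrightarrow> g' y = Hilbert_Choice.inv (blinfun_apply (f'(g y)))"
    "\<And>y. y \<in> V \<Longrightarrow> bij (blinfun_apply (f'(g y)))"
    using inverse_function_theorem[OF assms(1) d cont assms(3) inv] by metis
  have gU: "g y \<in> U" if "y \<in> V" for y using *(2,6) that by (auto simp: homeomorphism_def)
  have gk: "Ck_on k V g" for k
  proof (induction k)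
    case 0
    then show ?case using *(6) by (simp add: homeomorphism_def)
  next
    case (Suc k)
    show ?case
    proof (rule Ck_on_SucI[OF *(4) *(7)])
      show "Ck_on k V (\<lambda>y. g' y v)" for v
      proof (rule Ck_on_linear_system_solution[OF *(4), where A = "\<lambda>y. frechet_derivative f (at (g y))"])
        fix y assume y: "y \<in> V"
        show "linear (frechet_derivative f (at (g y)))"
          by (rule has_derivative_linear[OF der[OF gU[OF y]]])
        show "inj (frechet_derivative f (at (g y)))"
          using *(9)[OF y] app[OF gU[OF y]] by (simp add: bij_is_inj)
        show "frechet_derivative f (at (g y)) (g' y v) = v"
          using *(8,9)[OF y] app[OF gU[OF y]] by (simp add: bij_is_surj surj_f_inv_f)
      next
        fix b
        have "Ck_on k U (\<lambda>x. frechet_derivative f (at x) b)" using assms(2)[of "Suc k"] by simp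
        then show "Ck_on k V (\<lambda>y. frechet_derivative f (at (g y)) b)"
          using Ck_on_compose[OF *(4) assms(1) Suc, of "\<lambda>x. frechet_derivative f (at x) b"] gU by blast
      qed (rule Ck_on_const)
    qed
  qed
  show thesis
  proof (rule that[OF *(4,5) gk])
    show "g y \<in> U \<and> f (g y) = y" if "y \<in> V" for y
      using gU[OF that] *(6) that by (auto simp: homeomorphism_def)
    show "g (f x0) = x0" using *(3,6) by (auto simp: homeomorphism_def)
  qed
qed

text \<open>Let \<open>R\<close> be a linear right inverse of \<open>D\<close> on its range \<open>M\<close>, defined on the whole space. Then
\<open>D \<circ> R\<close> is a projection onto \<open>M\<close>, and \<open>F z = f (x0 + R z) + (z - D (R z))\<close> has the identity as its
derivative at 0. If \<open>g\<close> inverts \<open>F\<close> near \<open>f x0\<close> and \<open>y \<in> M\<close>, then in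
\<open>F (g y) = y\<close> everything except \<open>g y\<close> is visibly in \<open>M\<close>; so \<open>g y\<close> is fixed by the projection,
the correction term vanishes, and \<open>f (x0 + R (g y)) = y\<close>.\<close>

lemma smooth_local_section:
  fixes f :: "'a::euclidean_space \<Rightarrow> 'a"
  assumes "open U" "\<And>k. Ck_on k U f" "x0 \<in> U" "f ` U \<subseteq> M"
    and D: "(f has_derivative D) (at x0)" "range D = M"
  obtains V s where "open V" "f x0 \<in> V" "\<And>k. Ck_on k V s"
    "\<And>y. y \<in> V \<Longrightarrow> s y \<in> U" "\<And>y. y \<in> V \<inter> M \<Longrightarrow> f (s y) = y" "s (f x0) = x0"
proof -
  have linD: "linear D" using D(1) by (rule has_derivative_linear)
  have subM: "subspace M" using linear_subspace_image[OF linD subspace_UNIV] D(2) by simp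
  obtain R where R: "linear R" "\<And>y. y \<in> M \<Longrightarrow> D (R y) = y"
    using linear_exists_right_inverse_on[OF linD subspace_UNIV] D(2) by auto
  have R0: "R 0 = 0" using R(1) by (rule linear_0)
  have bl: "bounded_linear R" "bounded_linear (\<lambda>z. D (R z))"
    using R(1) linear_compose[OF R(1) linD] by (simp_all add: linear_conv_bounded_linear comp_def)
  define F where "F z = f (x0 + R z) + (z - D (R z))" for z
  define W where "W = (\<lambda>z. x0 + R z) -` U"
  have contR: "continuous_on UNIV (\<lambda>z. x0 + R z)"
    by (intro continuous_intros linear_continuous_on bl)
  then have W: "open W" unfolding W_def using assms(1) by (metis open_vimage)
  have W0: "0 \<in> W" using assms(3) R0 by (simp add: W_def)
  have Rk: "Ck_on k T (\<lambda>z. x0 + R z)" if "open T" for k T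
    by (intro Ck_on_add[OF that] Ck_on_const Ck_on_linear[OF that R(1)])
  have F0: "F 0 = f x0" using linear_0[OF linD] R0 by (simp add: F_def)
  have Fk: "Ck_on k W F" for k
    unfolding F_def using linear_compose[OF R(1) linD]
    by (intro Ck_on_add[OF W] Ck_on_diff[OF W] Ck_on_id[OF W] Ck_on_linear[OF W]
        Ck_on_compose[OF W assms(1) Rk[OF W] assms(2)]) (auto simp: W_def comp_def)
  have "((\<lambda>z. x0 + R z) has_derivative (\<lambda>u. 0 + R u)) (at 0)"
    by (intro has_derivative_add has_derivative_const bounded_linear_imp_has_derivative bl)
  then have "((\<lambda>z. x0 + R z) has_derivative R) (at 0)" by simp
  moreover have "(f has_derivative D) (at (x0 + R 0))" using D(1) R0 by simp
  ultimately have "((\<lambda>z. f (x0 + R z)) has_derivative (\<lambda>u. D (R u))) (at 0)"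
    by (rule has_derivative_compose)
  then have "(F has_derivative (\<lambda>u. D (R u) + (u - D (R u)))) (at 0)"
    unfolding F_def
    by (intro has_derivative_add has_derivative_diff has_derivative_ident bounded_linear_imp_has_derivative bl)
  then have "(F has_derivative (\<lambda>u. u)) (at 0)" by simp
  from smooth_inverse_function[OF W Fk W0 this] obtain V g where g: "open V" "F 0 \<in> V"
    "\<And>k. Ck_on k V g" "\<And>y. y \<in> V \<Longrightarrow> g y \<in> W \<and> F (g y) = y" "g (F 0) = 0" by blast
  show thesis
  proof
    show "open V" "f x0 \<in> V" using g F0 by simp_all
    show "Ck_on k V (\<lambda>y. x0 + R (g y))" for k
      by (rule Ck_on_add[OF g(1) Ck_on_const Ck_on_bounded_linear[OF g(1) bl(1) g(3)]])
    show "x0 + R (g y) \<in> U" if "y \<in> V" for y using g(4)[OF that] by (simp add: W_def)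
    show "f (x0 + R (g y)) = y" if y: "y \<in> V \<inter> M" for y
    proof -
      have "g y = y - f (x0 + R (g y)) + D (R (g y))" "x0 + R (g y) \<in> U"
        using g(4)[of y] y by (auto simp: F_def W_def algebra_simps)
      moreover have "D (R (g y)) \<in> M" using D(2) by blast
      ultimately have "g y \<in> M" using subM y assms(4)
        by (metis (no_types) IntD2 image_subset_iff subspace_add subspace_diff)
      then have "F (g y) = f (x0 + R (g y))" using R(2) by (simp add: F_def)
      then show ?thesis using g(4) y by simp
    qed
    show "x0 + R (g (f x0)) = x0" using g(5) F0 R0 by simp
  qed
qed

section \<open>Charts and smooth maps\<close>

lemma chart_open: "smooth_manifold M \<Longrightarrow> (U, \<phi>) \<in> atlas M \<Longrightarrow> openin (mtop M) U"
  unfolding smooth_manifold_def by blast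

lemma chart_subset_pts: "smooth_manifold M \<Longrightarrow> (U, \<phi>) \<in> atlas M \<Longrightarrow> U \<subseteq> pts M"
  by (rule openin_subset[OF chart_open])

lemma chart_homeomorphic:
  "smooth_manifold M \<Longrightarrow> (U, \<phi>) \<in> atlas M \<Longrightarrow>
    homeomorphic_map (subtopology (mtop M) U) (top_of_set (\<phi> ` U)) \<phi>"
  unfolding smooth_manifold_def by blast

lemma chart_image_open:
  "smooth_manifold M \<Longrightarrow> (U, \<phi>) \<in> atlas M \<Longrightarrow> openin (top_of_set (model M)) (\<phi> ` U)"
  unfolding smooth_manifold_def by blast

lemma chart_image_subset_model:
  "smooth_manifold M \<Longrightarrow> (U, \<phi>) \<in> atlas M \<Longrightarrow> \<phi> ` U \<subseteq> model M"
  using openin_subset[OF chart_image_open] by simp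

lemma chart_transition:
  assumes "smooth_manifold M" "(U, \<phi>) \<in> atlas M" "(V, \<psi>) \<in> atlas M"
  shows "smooth_on (\<phi> ` (U \<inter> V)) (\<lambda>x. \<psi> (inv_into U \<phi> x))"
proof -
  have "\<forall>(U, \<phi>)\<in>atlas M. \<forall>(V, \<psi>)\<in>atlas M. smooth_on (\<phi> ` (U \<inter> V)) (\<lambda>x. \<psi> (inv_into U \<phi> x))"
    using assms(1) unfolding smooth_manifold_def by (elim conjE)
  from bspec[OF this assms(2)]
  have "\<forall>(V, \<psi>)\<in>atlas M. smooth_on (\<phi> ` (U \<inter> V)) (\<lambda>x. \<psi> (inv_into U \<phi> x))" by simp
  from bspec[OF this assms(3)] show ?thesis by simp
qed

lemma chart_inj_on:
  assumes "smooth_manifold M" "(U, \<phi>) \<in> atlas M"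
  shows "inj_on \<phi> U"
  using homeomorphic_imp_injective_map[OF chart_homeomorphic[OF assms]] chart_subset_pts[OF assms]
  by (simp add: Int_absorb1)

lemma inv_chart:
  "smooth_manifold M \<Longrightarrow> (U, \<phi>) \<in> atlas M \<Longrightarrow> p \<in> U \<Longrightarrow> inv_into U \<phi> (\<phi> p) = p"
  by (rule inv_into_f_f[OF chart_inj_on])

lemma chart_image_openin_image:
  assumes "smooth_manifold M" "(U, \<phi>) \<in> atlas M" "openin (mtop M) W" "W \<subseteq> U"
  shows "openin (top_of_set (\<phi> ` U)) (\<phi> ` W)"
proof -
  have "openin (subtopology (mtop M) U) W"
    using assms(3,4) by (simp add: openin_subset_topspace_eq openin_subtopology) blast
  then show ?thesis
    using homeomorphic_map_openness[OF chart_homeomorphic[OF assms(1,2)]] assms(4)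
      chart_subset_pts[OF assms(1,2)] by (simp add: Int_absorb1)
qed

lemma chart_image_openin:
  assumes "smooth_manifold M" "(U, \<phi>) \<in> atlas M" "openin (mtop M) W" "W \<subseteq> U"
  shows "openin (top_of_set (model M)) (\<phi> ` W)"
  using openin_trans[OF chart_image_openin_image[OF assms] chart_image_open[OF assms(1,2)]] .

lemma chart_image_open_UNIV:
  assumes "smooth_manifold M" "model M = UNIV" "(U, \<phi>) \<in> atlas M" "openin (mtop M) W" "W \<subseteq> U"
  shows "open (\<phi> ` W)"
  using chart_image_openin[OF assms(1,3-5)] assms(2) by simp

lemma chart_preimage_open:
  assumes "smooth_manifold M" "(U, \<phi>) \<in> atlas M" "open T"
  shows "openin (mtop M) {q \<in> U. \<phi> q \<in> T}"
proof -
  have "openin (subtopology (mtop M) U) {q \<in> topspace (subtopology (mtop M) U). \<phi> q \<in> \<phi> ` U \<inter> T}"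
    by (rule openin_continuous_map_preimage[OF homeomorphic_imp_continuous_map[OF chart_homeomorphic[OF assms(1,2)]]])
       (simp add: assms(3) openin_open_Int)
  then have "openin (subtopology (mtop M) U) {q \<in> U. \<phi> q \<in> T}"
    using chart_subset_pts[OF assms(1,2)] by (auto simp: Int_absorb1 elim!: back_subst[of "openin _"])
  then show ?thesis by (rule openin_trans_full[OF _ chart_open[OF assms(1,2)]])
qed

lemma chart_at_in_atlas:
  assumes "smooth_manifold M" "p \<in> pts M"
  obtains U \<phi> where "chart_at M p = (U, \<phi>)" "(U, \<phi>) \<in> atlas M" "p \<in> U"
    "coords_at M p = \<phi>" "inv_coords_at M p = inv_into U \<phi>"
proof -
  have "\<Union> (fst ` atlas M) = pts M" using assms(1) unfolding smooth_manifold_def by blast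
  with assms(2) have "p \<in> \<Union> (fst ` atlas M)" by (simp only:)
  then have "\<exists>c. c \<in> atlas M \<and> p \<in> fst c" by blast
  then have "chart_at M p \<in> atlas M \<and> p \<in> fst (chart_at M p)"
    unfolding chart_at_def by (rule someI_ex)
  then show thesis
    by (intro that[of "fst (chart_at M p)" "snd (chart_at M p)"])
       (auto simp: coords_at_def inv_coords_at_def)
qed

lemma smooth_map_preimage_open:
  assumes "smooth_map M D N f" "openin (mtop M) D" "openin (mtop N) V"
  shows "openin (mtop M) {p \<in> D. f p \<in> V}"
proof -
  have "continuous_map (subtopology (mtop M) D) (mtop N) f"
    using assms(1) unfolding smooth_map_def by blast
  from openin_continuous_map_preimage[OF this assms(3)]
  have "openin (subtopology (mtop M) D) {p \<in> D. f p \<in> V}"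
    using openin_subset[OF assms(2)] by (simp add: Int_absorb1)
  then show ?thesis by (rule openin_trans_full[OF _ assms(2)])
qed

lemma smooth_map_in_pts:
  assumes "smooth_map M D N f" "p \<in> D" "D \<subseteq> pts M"
  shows "f p \<in> pts N"
proof -
  have "continuous_map (subtopology (mtop M) D) (mtop N) f"
    using assms(1) unfolding smooth_map_def by blast
  then show ?thesis using assms(2,3) by (auto simp: continuous_map_def Pi_iff)
qed

lemma smooth_map_smooth_on:
  "smooth_map M D N f \<Longrightarrow> (U, \<phi>) \<in> atlas M \<Longrightarrow> (V, \<psi>) \<in> atlas N \<Longrightarrow>
    smooth_on (\<phi> ` {p \<in> U \<inter> D. f p \<in> V}) (\<lambda>x. \<psi> (f (inv_into U \<phi> x)))"
  unfolding smooth_map_def by blast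

lemma smooth_map_subset:
  assumes "smooth_map M D N f" "D' \<subseteq> D"
  shows "smooth_map M D' N f"
  unfolding smooth_map_def
proof (intro conjI ballI, safe)
  show "continuous_map (subtopology (mtop M) D') (mtop N) f"
    using assms continuous_map_from_subtopology_mono unfolding smooth_map_def by blast
  show "smooth_on (\<phi> ` {p \<in> U \<inter> D'. f p \<in> V}) (\<lambda>x. \<psi> (f (inv_into U \<phi> x)))"
    if "(U, \<phi>) \<in> atlas M" "(V, \<psi>) \<in> atlas N" for U \<phi> V \<psi>
    using assms(2) by (intro smooth_on_subset[OF smooth_map_smooth_on[OF assms(1) that]]) auto
qed

lemma smooth_map_cong:
  assumes M: "smooth_manifold M" and "smooth_map M D N f" "\<And>p. p \<in> D \<Longrightarrow> f p = g p"
  shows "smooth_map M D N g"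
  unfolding smooth_map_def
proof (intro conjI ballI, safe)
  show "continuous_map (subtopology (mtop M) D) (mtop N) g"
    by (rule continuous_map_eq[of _ _ f]) (use assms in \<open>auto simp: smooth_map_def\<close>)
  fix U \<phi> V \<psi> assume c: "(U, \<phi>) \<in> atlas M" "(V, \<psi>) \<in> atlas N"
  have "{p \<in> U \<inter> D. f p \<in> V} = {p \<in> U \<inter> D. g p \<in> V}" using assms(3) by auto
  with smooth_map_smooth_on[OF assms(2) c]
  have "smooth_on (\<phi> ` {p \<in> U \<inter> D. g p \<in> V}) (\<lambda>x. \<psi> (f (inv_into U \<phi> x)))" by simp
  then show "smooth_on (\<phi> ` {p \<in> U \<inter> D. g p \<in> V}) (\<lambda>x. \<psi> (g (inv_into U \<phi> x)))"
    by (rule smooth_on_cong) (use assms(3) in \<open>auto simp: inv_chart[OF M c(1)]\<close>)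
qed

lemma smooth_map_ident:
  assumes "smooth_manifold M"
  shows "smooth_map M D M (\<lambda>p. p)"
  unfolding smooth_map_def
proof (intro conjI ballI, safe)
  show "continuous_map (subtopology (mtop M) D) (mtop M) (\<lambda>p. p)"
    by (simp add: continuous_map_from_subtopology)
  show "smooth_on (\<phi> ` {p \<in> U \<inter> D. p \<in> V}) (\<lambda>x. \<psi> (inv_into U \<phi> x))"
    if "(U, \<phi>) \<in> atlas M" "(V, \<psi>) \<in> atlas M" for U \<phi> V \<psi>
    by (rule smooth_on_subset[OF chart_transition[OF assms that]]) auto
qed

text \<open>No single chart of the middle manifold need cover the image of a chart domain, so smoothness is
checked on the relatively open pieces mapped into one chart each.\<close>

lemma smooth_map_compose:
  assumes M: "smooth_manifold M" and N: "smooth_manifold N"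
    and f: "smooth_map M D N f" and D: "openin (mtop M) D"
    and g: "smooth_map N E Q g" and fD: "f ` D \<subseteq> E"
  shows "smooth_map M D Q (\<lambda>p. g (f p))"
  unfolding smooth_map_def
proof (intro conjI ballI, safe)
  have "continuous_map (subtopology (mtop M) D) (subtopology (mtop N) E) f"
    using f fD openin_subset[OF D] by (auto simp: smooth_map_def continuous_map_in_subtopology)
  moreover have "continuous_map (subtopology (mtop N) E) (mtop Q) g"
    using g by (simp add: smooth_map_def)
  ultimately show "continuous_map (subtopology (mtop M) D) (mtop Q) (\<lambda>p. g (f p))"
    using continuous_map_compose by (fastforce simp: comp_def)
  fix U \<phi> W \<kappa> assume c: "(U, \<phi>) \<in> atlas M" "(W, \<kappa>) \<in> atlas Q"
  let ?S = "{p \<in> U \<inter> D. g (f p) \<in> W}"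
  show "smooth_on (\<phi> ` ?S) (\<lambda>x. \<kappa> (g (f (inv_into U \<phi> x))))"
  proof (rule smooth_on_local)
    fix x assume "x \<in> \<phi> ` ?S"
    then obtain p where p: "p \<in> ?S" "x = \<phi> p" by blast
    have "f p \<in> pts N" using smooth_map_in_pts[OF f _ openin_subset[OF D]] p by blast
    then obtain V \<psi> where v: "(V, \<psi>) \<in> atlas N" "f p \<in> V"
      using chart_at_in_atlas[OF N] by metis
    let ?T = "{p \<in> ?S. f p \<in> V}"
    have "openin (mtop M) (U \<inter> {p \<in> D. f p \<in> V})"
      by (intro openin_Int chart_open[OF M c(1)] smooth_map_preimage_open[OF f D] chart_open[OF N v(1)])
    then have "openin (top_of_set (\<phi> ` U)) (\<phi> ` (U \<inter> {p \<in> D. f p \<in> V}))"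
      by (intro chart_image_openin_image[OF M c(1)]) auto
    then obtain T' where T': "open T'" "\<phi> ` (U \<inter> {p \<in> D. f p \<in> V}) = \<phi> ` U \<inter> T'"
      by (auto simp: openin_open)
    have "\<phi> ` ?T = \<phi> ` ?S \<inter> T'"
    proof
      show "\<phi> ` ?T \<subseteq> \<phi> ` ?S \<inter> T'" using T'(2) by blast
      show "\<phi> ` ?S \<inter> T' \<subseteq> \<phi> ` ?T"
      proof
        fix y assume "y \<in> \<phi> ` ?S \<inter> T'"
        then obtain q where q: "q \<in> ?S" "y = \<phi> q" "y \<in> T'" by blast
        then have "\<phi> q \<in> \<phi> ` (U \<inter> {p \<in> D. f p \<in> V})" using T'(2) by blast
        then have "q \<in> U \<inter> {p \<in> D. f p \<in> V}"
          using inj_on_image_mem_iff[OF chart_inj_on[OF M c(1)], of q "U \<inter> {p \<in> D. f p \<in> V}"] q by blast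
        then show "y \<in> \<phi> ` ?T" using q by blast
      qed
    qed
    then have "openin (top_of_set (\<phi> ` ?S)) (\<phi> ` ?T)" using T'(1) by (auto simp: openin_open)
    moreover have "x \<in> \<phi> ` ?T" using p v(2) by blast
    moreover have "smooth_on (\<phi> ` ?T) (\<lambda>x. \<kappa> (g (f (inv_into U \<phi> x))))"
    proof (rule smooth_on_cong)
      show "smooth_on (\<phi> ` ?T) (\<lambda>x. \<kappa> (g (inv_into V \<psi> (\<psi> (f (inv_into U \<phi> x))))))"
      proof (rule smooth_on_compose[where f = "\<lambda>x. \<psi> (f (inv_into U \<phi> x))"
            and g = "\<lambda>y. \<kappa> (g (inv_into V \<psi> y))"])
        show "smooth_on (\<phi> ` ?T) (\<lambda>x. \<psi> (f (inv_into U \<phi> x)))"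
          by (rule smooth_on_subset[OF smooth_map_smooth_on[OF f c(1) v(1)]]) auto
        show "smooth_on (\<psi> ` {q \<in> V \<inter> E. g q \<in> W}) (\<lambda>y. \<kappa> (g (inv_into V \<psi> y)))"
          by (rule smooth_map_smooth_on[OF g v(1) c(2)])
        show "(\<lambda>x. \<psi> (f (inv_into U \<phi> x))) ` \<phi> ` ?T \<subseteq> \<psi> ` {q \<in> V \<inter> E. g q \<in> W}"
          using fD by (auto simp: inv_chart[OF M c(1)])
      qed
    qed (auto simp: inv_chart[OF M c(1)] inv_chart[OF N v(1)])
    ultimately show "\<exists>T. openin (top_of_set (\<phi> ` ?S)) T \<and> x \<in> T \<and>
        smooth_on T (\<lambda>x. \<kappa> (g (f (inv_into U \<phi> x))))" by blast
  qed
qed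

section \<open>Tangent maps\<close>

lemma chart_expression_derivative:
  assumes M: "smooth_manifold M" "model M = UNIV" and N: "smooth_manifold N"
    and f: "smooth_map M D N f" and D: "openin (mtop M) D" "p \<in> D"
    and c: "(U, \<phi>) \<in> atlas M" "p \<in> U" "(V, \<psi>) \<in> atlas N" "f p \<in> V"
  shows "((\<lambda>x. \<psi> (f (inv_into U \<phi> x))) has_derivative
    frechet_derivative (\<lambda>x. \<psi> (f (inv_into U \<phi> x))) (at (\<phi> p))) (at (\<phi> p))"
proof -
  let ?S = "U \<inter> {p \<in> D. f p \<in> V}"
  have "openin (mtop M) ?S"
    by (intro openin_Int chart_open[OF M(1) c(1)] smooth_map_preimage_open[OF f D(1)] chart_open[OF N c(3)])
  then have "open (\<phi> ` ?S)" by (rule chart_image_open_UNIV[OF M c(1)]) simp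
  moreover have "?S = {p \<in> U \<inter> D. f p \<in> V}" by blast
  ultimately have "Ck_on (Suc 0) (\<phi> ` ?S) (\<lambda>x. \<psi> (f (inv_into U \<phi> x)))"
    using smooth_on_imp_Ck_on[of "\<phi> ` ?S"] smooth_map_smooth_on[OF f c(1,3)]
    by (simp del: Ck_on.simps)
  then show ?thesis by (rule Ck_on_Suc_has_derivative) (use c D in blast)
qed

text \<open>Stated for charts that need not be the preferred ones, so that it covers both tangent maps and
the changes of coordinates \<open>coord_vec\<close>. The map \<open>G\<close> includes the coordinates on its target.\<close>

lemma chart_chain_rule:
  assumes M: "smooth_manifold M" "model M = UNIV" and N: "smooth_manifold N"
    and f: "smooth_map M D N f" and D: "openin (mtop M) D" "p \<in> D"
    and c: "(U, \<phi>) \<in> atlas M" "p \<in> U" "(V, \<psi>) \<in> atlas N" "f p \<in> V"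
    and A: "((\<lambda>x. \<psi> (f (inv_into U \<phi> x))) has_derivative A) (at (\<phi> p))"
    and B: "((\<lambda>y. G (inv_into V \<psi> y)) has_derivative B) (at (\<psi> (f p)))"
  shows "((\<lambda>x. G (f (inv_into U \<phi> x))) has_derivative (\<lambda>u. B (A u))) (at (\<phi> p))"
proof -
  let ?S = "U \<inter> {p \<in> D. f p \<in> V}"
  have "openin (mtop M) ?S"
    by (intro openin_Int chart_open[OF M(1) c(1)] smooth_map_preimage_open[OF f D(1)] chart_open[OF N c(3)])
  then have op: "open (\<phi> ` ?S)" by (rule chart_image_open_UNIV[OF M c(1)]) simp
  have "((\<lambda>x. G (inv_into V \<psi> (\<psi> (f (inv_into U \<phi> x))))) has_derivative (\<lambda>u. B (A u))) (at (\<phi> p))"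
    using has_derivative_compose[OF A, of "\<lambda>y. G (inv_into V \<psi> y)" B] B
    by (simp add: inv_chart[OF M(1) c(1,2)])
  then show ?thesis
  proof (rule has_derivative_transform_within_open[OF _ op])
    show "\<phi> p \<in> \<phi> ` ?S" using c D by blast
    show "G (inv_into V \<psi> (\<psi> (f (inv_into U \<phi> x)))) = G (f (inv_into U \<phi> x))" if "x \<in> \<phi> ` ?S" for x
      using that by (auto simp: inv_chart[OF M(1) c(1)] inv_chart[OF N c(3)])
  qed
qed

lemma tangent_map_has_derivative:
  assumes M: "smooth_manifold M" "model M = UNIV" and N: "smooth_manifold N"
    and f: "smooth_map M D N f" and D: "openin (mtop M) D" "p \<in> D"
  shows "((\<lambda>x. coords_at N (f p) (f (inv_coords_at M p x))) has_derivative tangent_map M N f p)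
    (at (coords_at M p p))"
proof -
  have p: "p \<in> pts M" using D openin_subset by blast
  have fp: "f p \<in> pts N" by (rule smooth_map_in_pts[OF f D(2) openin_subset[OF D(1)]])
  obtain U \<phi> where "(U, \<phi>) \<in> atlas M" "p \<in> U" "coords_at M p = \<phi>" "inv_coords_at M p = inv_into U \<phi>"
    using chart_at_in_atlas[OF M(1) p] by metis
  moreover obtain V \<psi> where "(V, \<psi>) \<in> atlas N" "f p \<in> V" "coords_at N (f p) = \<psi>"
    using chart_at_in_atlas[OF N fp] by metis
  ultimately show ?thesis
    using chart_expression_derivative[OF assms, of U \<phi> V \<psi>] by (simp add: tangent_map_def)
qed

lemma tangent_map_compose:
  assumes M: "smooth_manifold M" "model M = UNIV" and N: "smooth_manifold N" "model N = UNIV"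
    and Q: "smooth_manifold Q"
    and f: "smooth_map M D N f" and D: "openin (mtop M) D" "p \<in> D"
    and g: "smooth_map N E Q g" and E: "openin (mtop N) E" "f p \<in> E"
  shows "tangent_map M Q (\<lambda>q. g (f q)) p \<xi> = tangent_map N Q g (f p) (tangent_map M N f p \<xi>)"
proof -
  have p: "p \<in> pts M" using D openin_subset by blast
  have fp: "f p \<in> pts N" by (rule smooth_map_in_pts[OF f D(2) openin_subset[OF D(1)]])
  obtain U \<phi> where c: "(U, \<phi>) \<in> atlas M" "p \<in> U" "coords_at M p = \<phi>" "inv_coords_at M p = inv_into U \<phi>"
    using chart_at_in_atlas[OF M(1) p] by metis
  obtain V \<psi> where d: "(V, \<psi>) \<in> atlas N" "f p \<in> V" "coords_at N (f p) = \<psi>"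
    "inv_coords_at N (f p) = inv_into V \<psi>"
    using chart_at_in_atlas[OF N(1) fp] by metis
  have "((\<lambda>x. coords_at Q (g (f p)) (g (f (inv_into U \<phi> x)))) has_derivative
      (\<lambda>u. tangent_map N Q g (f p) (tangent_map M N f p u))) (at (\<phi> p))"
    by (rule chart_chain_rule[OF M N(1) f D c(1,2) d(1,2),
          where G = "\<lambda>q. coords_at Q (g (f p)) (g q)"])
       (use tangent_map_has_derivative[OF M N(1) f D] tangent_map_has_derivative[OF N Q g E] c d
         in simp_all)
  from frechet_derivative_at[OF this] show ?thesis
    using c unfolding tangent_map_def[of M Q] by metis
qed

lemma tangent_map_cong:
  assumes M: "smooth_manifold M" "model M = UNIV" and N: "smooth_manifold N"
    and f: "smooth_map M D N f" and D: "openin (mtop M) D" "p \<in> D"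
    and eq: "\<And>q. q \<in> D \<Longrightarrow> f q = g q"
  shows "tangent_map M N f p = tangent_map M N g p"
proof -
  have "p \<in> pts M" using D openin_subset by blast
  then obtain U \<phi> where c: "(U, \<phi>) \<in> atlas M" "p \<in> U" "coords_at M p = \<phi>" "inv_coords_at M p = inv_into U \<phi>"
    using chart_at_in_atlas[OF M(1)] by metis
  have "openin (mtop M) (U \<inter> D)" by (intro openin_Int chart_open[OF M(1) c(1)] D)
  then have op: "open (\<phi> ` (U \<inter> D))" by (rule chart_image_open_UNIV[OF M c(1)]) simp
  have "((\<lambda>x. coords_at N (f p) (f (inv_into U \<phi> x))) has_derivative tangent_map M N f p) (at (\<phi> p))"
    using tangent_map_has_derivative[OF M N f D] c by simp
  then have "((\<lambda>x. coords_at N (g p) (g (inv_into U \<phi> x))) has_derivative tangent_map M N f p) (at (\<phi> p))"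
  proof (rule has_derivative_transform_within_open[OF _ op])
    show "\<phi> p \<in> \<phi> ` (U \<inter> D)" using c D by blast
    fix x assume "x \<in> \<phi> ` (U \<inter> D)"
    then have "inv_into U \<phi> x \<in> D" by (auto simp: inv_chart[OF M(1) c(1)])
    then show "coords_at N (f p) (f (inv_into U \<phi> x)) = coords_at N (g p) (g (inv_into U \<phi> x))"
      by (simp add: eq D)
  qed
  from frechet_derivative_at[OF this] show ?thesis
    using c unfolding tangent_map_def[of M N g] by metis
qed

lemma tangent_map_ident:
  assumes M: "smooth_manifold M" "model M = UNIV" and p: "p \<in> pts M"
  shows "tangent_map M M (\<lambda>q. q) p \<xi> = \<xi>"
proof -
  obtain U \<phi> where c: "(U, \<phi>) \<in> atlas M" "p \<in> U" "coords_at M p = \<phi>" "inv_coords_at M p = inv_into U \<phi>"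
    using chart_at_in_atlas[OF M(1) p] by metis
  have op: "open (\<phi> ` U)"
    by (rule chart_image_open_UNIV[OF M c(1) chart_open[OF M(1) c(1)]]) simp
  have "((\<lambda>x. \<phi> (inv_into U \<phi> x)) has_derivative (\<lambda>u. u)) (at (\<phi> p))"
    by (rule has_derivative_transform_within_open[OF has_derivative_ident op])
       (use c in \<open>auto simp: f_inv_into_f\<close>)
  from frechet_derivative_at[OF this] show ?thesis
    using c unfolding tangent_map_def by metis
qed

text \<open>The transition map in the opposite direction provides a left inverse of the derivative, which
suffices in equal dimensions.\<close>

lemma coord_vec_bij:
  assumes M: "smooth_manifold M" "model M = UNIV" and c: "(U, \<phi>) \<in> atlas M" "p \<in> U"
  shows "linear (coord_vec M (U, \<phi>) p) \<and> bij (coord_vec M (U, \<phi>) p)"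
proof -
  have p: "p \<in> pts M" using chart_subset_pts[OF M(1) c(1)] c(2) by blast
  obtain V \<psi> where v: "(V, \<psi>) \<in> atlas M" "p \<in> V" "coords_at M p = \<psi>"
    using chart_at_in_atlas[OF M(1) p] by metis
  note idm = smooth_map_ident[OF M(1), of "pts M"] openin_topspace[of "mtop M"] p
  let ?A = "coord_vec M (U, \<phi>) p"
  let ?B = "frechet_derivative (\<lambda>x. \<phi> (inv_into V \<psi> x)) (at (\<psi> p))"
  have A: "((\<lambda>x. \<psi> (inv_into U \<phi> x)) has_derivative ?A) (at (\<phi> p))"
    using chart_expression_derivative[OF M M(1) idm c v(1,2)] v(3) by (simp add: coord_vec_def)
  have B: "((\<lambda>x. \<phi> (inv_into V \<psi> x)) has_derivative ?B) (at (\<psi> p))"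
    using chart_expression_derivative[OF M M(1) idm v(1,2) c] by simp
  have lin: "linear ?A" using A by (rule has_derivative_linear)
  have AB: "((\<lambda>x. \<phi> (inv_into U \<phi> x)) has_derivative (\<lambda>u. ?B (?A u))) (at (\<phi> p))"
    by (rule chart_chain_rule[OF M M(1) idm c v(1,2) A B])
  have op: "open (\<phi> ` U)"
    by (rule chart_image_open_UNIV[OF M c(1) chart_open[OF M(1) c(1)]]) simp
  have "((\<lambda>x. x) has_derivative (\<lambda>u. ?B (?A u))) (at (\<phi> p))"
    by (rule has_derivative_transform_within_open[OF AB op])
       (use c in \<open>auto simp: f_inv_into_f\<close>)
  then have "(\<lambda>u. ?B (?A u)) = (\<lambda>u. u)" by (rule has_derivative_unique[OF _ has_derivative_ident])
  then have "inj ?A" by (metis injI)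
  with lin show ?thesis using linear_injective_imp_surjective by (auto simp: bij_def)
qed

section \<open>Smooth functions along submersions\<close>

lemma smooth_fun_compose:
  assumes M: "smooth_manifold M" and N: "smooth_manifold N"
    and h: "smooth_map M (pts M) N h" and f: "smooth_fun N f"
  shows "smooth_fun M (\<lambda>p. f (h p))"
  unfolding smooth_fun_def
proof safe
  fix U \<phi> assume c: "(U, \<phi>) \<in> atlas M"
  show "smooth_on (\<phi> ` U) (\<lambda>x. f (h (inv_into U \<phi> x)))"
  proof (rule smooth_on_local)
    fix x assume "x \<in> \<phi> ` U"
    then obtain p where p: "p \<in> U" "x = \<phi> p" by blast
    have U: "U \<subseteq> pts M" by (rule chart_subset_pts[OF M c])
    have "h p \<in> pts N" using smooth_map_in_pts[OF h] p(1) U by blast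
    then obtain V \<psi> where v: "(V, \<psi>) \<in> atlas N" "h p \<in> V"
      using chart_at_in_atlas[OF N] by metis
    let ?T = "{p \<in> U \<inter> pts M. h p \<in> V}"
    have "openin (mtop M) (U \<inter> {p \<in> pts M. h p \<in> V})"
      by (intro openin_Int chart_open[OF M c] smooth_map_preimage_open[OF h] chart_open[OF N v(1)])
         simp
    moreover have "U \<inter> {p \<in> pts M. h p \<in> V} = ?T" by blast
    ultimately have "openin (top_of_set (\<phi> ` U)) (\<phi> ` ?T)"
      by (intro chart_image_openin_image[OF M c]) auto
    moreover have "x \<in> \<phi> ` ?T" using p v U by blast
    moreover have "smooth_on (\<phi> ` ?T) (\<lambda>x. f (h (inv_into U \<phi> x)))"
    proof (rule smooth_on_cong)
      show "smooth_on (\<phi> ` ?T) (\<lambda>x. f (inv_into V \<psi> (\<psi> (h (inv_into U \<phi> x)))))"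
        by (rule smooth_on_compose[where f = "\<lambda>x. \<psi> (h (inv_into U \<phi> x))" and T = "\<psi> ` V"
              and g = "\<lambda>y. f (inv_into V \<psi> y)", OF smooth_map_smooth_on[OF h c v(1)]])
           (use f v(1) in \<open>auto simp: smooth_fun_def inv_chart[OF M c]\<close>)
    qed (auto simp: inv_chart[OF M c] inv_chart[OF N v(1)])
    ultimately show "\<exists>T. openin (top_of_set (\<phi> ` U)) T \<and> x \<in> T \<and>
        smooth_on T (\<lambda>x. f (h (inv_into U \<phi> x)))" by blast
  qed
qed

text \<open>Near any point of \<open>X\<close> there is a smooth section \<open>s\<close> of \<open>h\<close>, and there \<open>g = (g \<circ> h) \<circ> s\<close>. The section
is constructed in the chart \<open>\<kappa>\<close> in which the tangent map of \<open>h\<close> is expressed; an arbitrary chart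
\<open>\<psi>\<close> is then reached by a transition map. Since \<open>model X\<close> may be a proper subspace of the ambient space, the
section is defined on an open set \<open>V'\<close> of the ambient space but inverts \<open>h\<close> only over the model.\<close>

lemma smooth_fun_descends_along_submersion:
  fixes M :: "('p, 'e::euclidean_space) mfd" and X :: "('x, 'e) mfd"
  assumes M: "smooth_manifold M" "model M = UNIV" and X: "smooth_manifold X"
    and h: "smooth_map M (pts M) X h" and surj: "pts X \<subseteq> h ` pts M"
    and submersion: "\<And>p. p \<in> pts M \<Longrightarrow> range (tangent_map M X h p) = model X"
    and gh: "smooth_fun M (\<lambda>p. g (h p))"
  shows "smooth_fun X g"
  unfolding smooth_fun_def
proof safe
  fix V \<psi> assume v: "(V, \<psi>) \<in> atlas X"
  show "smooth_on (\<psi> ` V) (\<lambda>x. g (inv_into V \<psi> x))"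
  proof (rule smooth_on_local)
    fix y assume "y \<in> \<psi> ` V"
    then obtain x where x: "x \<in> V" "y = \<psi> x" by blast
    then have "x \<in> pts X" using chart_subset_pts[OF X v] by blast
    then obtain p where p: "p \<in> pts M" "x = h p" using surj by blast
    obtain U \<phi> where c: "(U, \<phi>) \<in> atlas M" "p \<in> U" "coords_at M p = \<phi>" "inv_coords_at M p = inv_into U \<phi>"
      using chart_at_in_atlas[OF M(1) p(1)] by metis
    obtain W \<kappa> where w: "(W, \<kappa>) \<in> atlas X" "x \<in> W" "coords_at X x = \<kappa>"
      using chart_at_in_atlas[OF X \<open>x \<in> pts X\<close>] by metis
    let ?f = "\<lambda>z. \<kappa> (h (inv_into U \<phi> z))"
    let ?S = "{q \<in> U \<inter> pts M. h q \<in> W}"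
    have S: "?S = U \<inter> {q \<in> pts M. h q \<in> W}" by blast
    have "openin (mtop M) ?S"
      unfolding S
      by (intro openin_Int chart_open[OF M(1) c(1)] smooth_map_preimage_open[OF h] chart_open[OF X w(1)])
         simp
    then have op: "open (\<phi> ` ?S)" by (rule chart_image_open_UNIV[OF M c(1)]) auto
    have fk: "Ck_on k (\<phi> ` ?S) ?f" for k
      by (rule smooth_on_imp_Ck_on[OF op smooth_map_smooth_on[OF h c(1) w(1)]])
    have pS: "\<phi> p \<in> \<phi> ` ?S" using c p w by blast
    have fp: "?f (\<phi> p) = \<kappa> x" using inv_chart[OF M(1) c(1,2)] p by simp
    have "?f ` \<phi> ` ?S \<subseteq> \<kappa> ` W" by (auto simp: inv_chart[OF M(1) c(1)])
    then have fM: "?f ` \<phi> ` ?S \<subseteq> model X" using chart_image_subset_model[OF X w(1)] by blast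
    have der: "(?f has_derivative tangent_map M X h p) (at (\<phi> p))"
      using tangent_map_has_derivative[OF M X h openin_topspace p(1)] c w p by simp
    obtain V' s where s: "open V'" "?f (\<phi> p) \<in> V'" "\<And>k. Ck_on k V' s"
      "\<And>y. y \<in> V' \<Longrightarrow> s y \<in> \<phi> ` ?S" "\<And>y. y \<in> V' \<inter> model X \<Longrightarrow> ?f (s y) = y"
      by (rule smooth_local_section[OF op fk pS fM der submersion[OF p(1)]]) (rule that)
    have sec: "smooth_on (V' \<inter> \<kappa> ` W) (\<lambda>y. g (inv_into W \<kappa> y))"
    proof (rule smooth_on_cong)
      show "smooth_on (V' \<inter> \<kappa> ` W) (\<lambda>y. g (h (inv_into U \<phi> (s y))))"
      proof (rule smooth_on_compose[where f = s and T = "\<phi> ` U" and g = "\<lambda>z. g (h (inv_into U \<phi> z))"])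
        show "smooth_on (V' \<inter> \<kappa> ` W) s"
          by (rule smooth_on_subset[OF smooth_on_openI[OF s(1,3)]]) blast
        show "smooth_on (\<phi> ` U) (\<lambda>z. g (h (inv_into U \<phi> z)))"
          using gh c(1) unfolding smooth_fun_def by blast
        show "s ` (V' \<inter> \<kappa> ` W) \<subseteq> \<phi> ` U" using s(4) by blast
      qed
      show "g (h (inv_into U \<phi> (s y))) = g (inv_into W \<kappa> y)" if y: "y \<in> V' \<inter> \<kappa> ` W" for y
      proof -
        have "?f (s y) = y" using s(5) y chart_image_subset_model[OF X w(1)] by blast
        moreover have "h (inv_into U \<phi> (s y)) \<in> W"
          using s(4)[of y] y by (auto simp: inv_chart[OF M(1) c(1)])
        ultimately show ?thesis
          using inv_chart[OF X w(1), of "h (inv_into U \<phi> (s y))"] by simp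
      qed
    qed
    let ?T = "{q \<in> V \<inter> W. \<kappa> q \<in> V'}"
    have T: "?T = V \<inter> {q \<in> W. \<kappa> q \<in> V'}" by blast
    have "openin (mtop X) ?T"
      unfolding T by (intro openin_Int chart_open[OF X v] chart_preimage_open[OF X w(1) s(1)])
    then have "openin (top_of_set (\<psi> ` V)) (\<psi> ` ?T)"
      by (rule chart_image_openin_image[OF X v]) auto
    moreover have "y \<in> \<psi> ` ?T" using x w s(2) fp by auto
    moreover have "smooth_on (\<psi> ` ?T) (\<lambda>y. g (inv_into V \<psi> y))"
    proof (rule smooth_on_cong)
      show "smooth_on (\<psi> ` ?T) (\<lambda>y. g (inv_into W \<kappa> (\<kappa> (inv_into V \<psi> y))))"
      proof (rule smooth_on_compose[where f = "\<lambda>y. \<kappa> (inv_into V \<psi> y)" and g = "\<lambda>y. g (inv_into W \<kappa> y)",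
            OF _ sec])
        show "smooth_on (\<psi> ` ?T) (\<lambda>y. \<kappa> (inv_into V \<psi> y))"
          by (rule smooth_on_subset[OF chart_transition[OF X v w(1)]]) blast
      qed (auto simp: inv_chart[OF X v])
    qed (auto simp: inv_chart[OF X v] inv_chart[OF X w(1)])
    ultimately show "\<exists>T. openin (top_of_set (\<psi> ` V)) T \<and> y \<in> T \<and>
        smooth_on T (\<lambda>y. g (inv_into V \<psi> y))" by blast
  qed
qed

section \<open>Local equivalences and the classifying map\<close>

lemma act_in_pts:
  assumes "smooth_right_action G P act" "p \<in> pts P" "g \<in> G"
  shows "act p g \<in> pts P"
proof -
  have "continuous_map (prod_topology (mtop P) (top_of_set G)) (mtop P) (\<lambda>(p, g). act p g)"
    using assms(1) unfolding smooth_right_action_def by blast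
  then have "(\<lambda>(p, g). act p g) ` (pts P \<times> G) \<subseteq> pts P"
    using continuous_map_image_subset_topspace by fastforce
  then show ?thesis using assms(2,3) by auto
qed

lemma local_equivalence_ident:
  assumes P: "smooth_manifold P" "model P = UNIV" and act: "smooth_right_action G P act"
  shows "local_equivalence G P act \<theta> \<omega> (pts P) (pts P) (\<lambda>p. p)"
  unfolding local_equivalence_def
proof (intro conjI ballI allI)
  show "smooth_map P (pts P) P (\<lambda>p. p)" by (rule smooth_map_ident[OF P(1)])
  show "smooth_map P (pts P) P (inv_into (pts P) (\<lambda>p. p))"
    by (rule smooth_map_cong[OF P(1) smooth_map_ident[OF P(1)]])
       (metis inv_into_f_f inj_on_id2)
qed (auto simp: act_in_pts[OF act] tangent_map_ident[OF P] bij_betw_def)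

text \<open>The tangent map of the inverse is a right inverse of that of \<open>\<Phi>\<close>; inserting it in the
invariance of the forms under \<open>\<Phi>\<close> gives the invariance under the inverse.\<close>

lemma local_equivalence_inverse:
  assumes P: "smooth_manifold P" "model P = UNIV"
    and loc: "local_equivalence G P act \<theta> \<omega> U V \<Phi>"
  shows "local_equivalence G P act \<theta> \<omega> V U (inv_into U \<Phi>)"
proof -
  have UV: "openin (mtop P) U" "openin (mtop P) V"
    and sat: "\<And>p g. p \<in> U \<Longrightarrow> g \<in> G \<Longrightarrow> act p g \<in> U" "\<And>p g. p \<in> V \<Longrightarrow> g \<in> G \<Longrightarrow> act p g \<in> V"
    and bij: "bij_betw \<Phi> U V"
    and sm: "smooth_map P U P \<Phi>" "smooth_map P V P (inv_into U \<Phi>)"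
    and eqv: "\<And>p g. p \<in> U \<Longrightarrow> g \<in> G \<Longrightarrow> \<Phi> (act p g) = act (\<Phi> p) g"
    and th: "\<And>p \<xi>. p \<in> U \<Longrightarrow> \<theta> (\<Phi> p) (tangent_map P P \<Phi> p \<xi>) = \<theta> p \<xi>"
    and om: "\<And>p \<xi>. p \<in> U \<Longrightarrow> \<omega> (\<Phi> p) (tangent_map P P \<Phi> p \<xi>) = \<omega> p \<xi>"
    using loc unfolding local_equivalence_def by blast+
  let ?\<Psi> = "inv_into U \<Phi>"
  have bij': "bij_betw ?\<Psi> V U" by (rule bij_betw_inv_into[OF bij])
  have left: "?\<Psi> (\<Phi> p) = p" if "p \<in> U" for p by (rule bij_betw_inv_into_left[OF bij that])
  have right: "\<Phi> (?\<Psi> q) = q" if "q \<in> V" for q by (rule bij_betw_inv_into_right[OF bij that])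
  have inU: "?\<Psi> q \<in> U" if "q \<in> V" for q using bij' that by (rule bij_betw_apply)
  have T: "tangent_map P P \<Phi> (?\<Psi> q) (tangent_map P P ?\<Psi> q \<xi>) = \<xi>" if q: "q \<in> V" for q \<xi>
  proof -
    have "tangent_map P P \<Phi> (?\<Psi> q) (tangent_map P P ?\<Psi> q \<xi>) = tangent_map P P (\<lambda>r. \<Phi> (?\<Psi> r)) q \<xi>"
      by (rule tangent_map_compose[OF P P P(1) sm(2) UV(2) q sm(1) UV(1) inU[OF q], symmetric])
    also have "tangent_map P P (\<lambda>r. \<Phi> (?\<Psi> r)) q = tangent_map P P (\<lambda>r. r) q"
      by (rule tangent_map_cong[OF P P(1) smooth_map_ident[OF P(1)] UV(2) q, symmetric]) (simp add: right)
    also have "\<dots> \<xi> = \<xi>" using tangent_map_ident[OF P] q openin_subset[OF UV(2)] by blast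
    finally show ?thesis .
  qed
  show ?thesis
    unfolding local_equivalence_def
  proof (intro conjI ballI allI)
    show "smooth_map P U P (inv_into V ?\<Psi>)"
    proof (rule smooth_map_cong[OF P(1) sm(1)])
      show "\<Phi> p = inv_into V ?\<Psi> p" if "p \<in> U" for p
        using bij_betw_inv_into_left[OF bij', of "\<Phi> p"] bij_betw_apply[OF bij that] left[OF that] by simp
    qed
    show "?\<Psi> (act q g) = act (?\<Psi> q) g" if "q \<in> V" "g \<in> G" for q g
      using eqv[OF inU[OF that(1)] that(2)] right[OF that(1)] left[OF sat(1)[OF inU[OF that(1)] that(2)]]
      by simp
    show "\<theta> (?\<Psi> q) (tangent_map P P ?\<Psi> q \<xi>) = \<theta> q \<xi>" if "q \<in> V" for q \<xi>
      using th[OF inU[OF that], of "tangent_map P P ?\<Psi> q \<xi>"] T[OF that] right[OF that] by simp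
    show "\<omega> (?\<Psi> q) (tangent_map P P ?\<Psi> q \<xi>) = \<omega> q \<xi>" if "q \<in> V" for q \<xi>
      using om[OF inU[OF that], of "tangent_map P P ?\<Psi> q \<xi>"] T[OF that] right[OF that] by simp
  qed (use UV sat bij' sm in auto)
qed

text \<open>The composite is defined on the part of \<open>U\<close> that \<open>\<Phi>\<close> maps into \<open>U'\<close>. This part and its image are again saturated
because \<open>\<Phi>\<close> and the inverse of \<open>\<Psi>\<close> are equivariant.\<close>

lemma local_equivalence_compose:
  assumes P: "smooth_manifold P" "model P = UNIV"
    and loc: "local_equivalence G P act \<theta> \<omega> U V \<Phi>" "local_equivalence G P act \<theta> \<omega> U' V' \<Psi>"
  shows "local_equivalence G P act \<theta> \<omega> {p \<in> U. \<Phi> p \<in> U'} {q \<in> V'. inv_into U' \<Psi> q \<in> V} (\<lambda>p. \<Psi> (\<Phi> p))"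
    (is "local_equivalence _ _ _ _ _ ?U ?V ?\<Theta>")
proof -
  have UV: "openin (mtop P) U" "openin (mtop P) V"
    and sat: "\<And>p g. p \<in> U \<Longrightarrow> g \<in> G \<Longrightarrow> act p g \<in> U" "\<And>p g. p \<in> V \<Longrightarrow> g \<in> G \<Longrightarrow> act p g \<in> V"
    and bij: "bij_betw \<Phi> U V"
    and sm: "smooth_map P U P \<Phi>" "smooth_map P V P (inv_into U \<Phi>)"
    and eqv: "\<And>p g. p \<in> U \<Longrightarrow> g \<in> G \<Longrightarrow> \<Phi> (act p g) = act (\<Phi> p) g"
    and th: "\<And>p \<xi>. p \<in> U \<Longrightarrow> \<theta> (\<Phi> p) (tangent_map P P \<Phi> p \<xi>) = \<theta> p \<xi>"
    and om: "\<And>p \<xi>. p \<in> U \<Longrightarrow> \<omega> (\<Phi> p) (tangent_map P P \<Phi> p \<xi>) = \<omega> p \<xi>"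
    using loc(1) unfolding local_equivalence_def by blast+
  have UV': "openin (mtop P) U'" "openin (mtop P) V'"
    and sat': "\<And>p g. p \<in> U' \<Longrightarrow> g \<in> G \<Longrightarrow> act p g \<in> U'" "\<And>p g. p \<in> V' \<Longrightarrow> g \<in> G \<Longrightarrow> act p g \<in> V'"
    and bij': "bij_betw \<Psi> U' V'"
    and sm': "smooth_map P U' P \<Psi>" "smooth_map P V' P (inv_into U' \<Psi>)"
    and eqv': "\<And>p g. p \<in> U' \<Longrightarrow> g \<in> G \<Longrightarrow> \<Psi> (act p g) = act (\<Psi> p) g"
    and th': "\<And>p \<xi>. p \<in> U' \<Longrightarrow> \<theta> (\<Psi> p) (tangent_map P P \<Psi> p \<xi>) = \<theta> p \<xi>"
    and om': "\<And>p \<xi>. p \<in> U' \<Longrightarrow> \<omega> (\<Psi> p) (tangent_map P P \<Psi> p \<xi>) = \<omega> p \<xi>"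
    using loc(2) unfolding local_equivalence_def by blast+
  have inv_eqv: "inv_into U' \<Psi> (act q g) = act (inv_into U' \<Psi> q) g" if "q \<in> V'" "g \<in> G" for q g
    using local_equivalence_inverse[OF P loc(2)] that unfolding local_equivalence_def by blast
  have left: "inv_into U \<Phi> (\<Phi> p) = p" if "p \<in> U" for p by (rule bij_betw_inv_into_left[OF bij that])
  have right: "\<Phi> (inv_into U \<Phi> q) = q" if "q \<in> V" for q by (rule bij_betw_inv_into_right[OF bij that])
  have left': "inv_into U' \<Psi> (\<Psi> p) = p" if "p \<in> U'" for p by (rule bij_betw_inv_into_left[OF bij' that])
  have right': "\<Psi> (inv_into U' \<Psi> q) = q" if "q \<in> V'" for q by (rule bij_betw_inv_into_right[OF bij' that])
  have img: "\<Phi> p \<in> V" if "p \<in> U" for p using bij_betw_apply[OF bij that] .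
  have img': "\<Psi> p \<in> V'" if "p \<in> U'" for p using bij_betw_apply[OF bij' that] .
  have pre: "inv_into U \<Phi> q \<in> U" if "q \<in> V" for q
    using bij_betw_apply[OF bij_betw_inv_into[OF bij] that] .
  have pre': "inv_into U' \<Psi> q \<in> U'" if "q \<in> V'" for q
    using bij_betw_apply[OF bij_betw_inv_into[OF bij'] that] .
  have bij\<Theta>: "bij_betw ?\<Theta> ?U ?V"
    by (rule bij_betw_byWitness[where f' = "\<lambda>q. inv_into U \<Phi> (inv_into U' \<Psi> q)"])
       (auto simp: left right left' right' img img' pre pre')
  have opU: "openin (mtop P) ?U" by (rule smooth_map_preimage_open[OF sm(1) UV(1) UV'(1)])
  have opV: "openin (mtop P) ?V" by (rule smooth_map_preimage_open[OF sm'(2) UV'(2) UV(2)])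
  have smU: "smooth_map P ?U P \<Phi>" by (rule smooth_map_subset[OF sm(1)]) blast
  have smV: "smooth_map P ?V P (inv_into U' \<Psi>)" by (rule smooth_map_subset[OF sm'(2)]) blast
  have T: "tangent_map P P ?\<Theta> p \<xi> = tangent_map P P \<Psi> (\<Phi> p) (tangent_map P P \<Phi> p \<xi>)"
    if p: "p \<in> U" "\<Phi> p \<in> U'" for p \<xi>
    by (rule tangent_map_compose[OF P P P(1) sm(1) UV(1) p(1) sm'(1) UV'(1) p(2)])
  show ?thesis
    unfolding local_equivalence_def
  proof (intro conjI ballI allI)
    show "smooth_map P ?U P ?\<Theta>"
      by (rule smooth_map_compose[OF P(1) P(1) smU opU sm'(1)]) blast
    have "smooth_map P ?V P (\<lambda>q. inv_into U \<Phi> (inv_into U' \<Psi> q))"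
      by (rule smooth_map_compose[OF P(1) P(1) smV opV sm(2)]) blast
    then show "smooth_map P ?V P (inv_into ?U ?\<Theta>)"
    proof (rule smooth_map_cong[OF P(1)])
      fix q assume q: "q \<in> ?V"
      let ?p = "inv_into U \<Phi> (inv_into U' \<Psi> q)"
      have "?p \<in> ?U" "?\<Theta> ?p = q" using q by (auto simp: right right' pre pre')
      then show "?p = inv_into ?U ?\<Theta> q"
        using bij_betw_inv_into_left[OF bij\<Theta>, of ?p] by simp
    qed
  qed (use opU opV bij\<Theta> in \<open>auto simp: sat sat' eqv eqv' inv_eqv T th th' om om'\<close>)
qed

lemma equivalence_rel_refl:
  assumes "smooth_manifold P" "model P = UNIV" "smooth_right_action G P act" "p \<in> pts P"
  shows "(p, p) \<in> equivalence_rel G P act \<theta> \<omega>"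
  using local_equivalence_ident[OF assms(1-3)] assms(4) unfolding equivalence_rel_def by blast

lemma sym_equivalence_rel:
  assumes "smooth_manifold P" "model P = UNIV"
  shows "sym (equivalence_rel G P act \<theta> \<omega>)"
proof (rule symI)
  fix p q assume "(p, q) \<in> equivalence_rel G P act \<theta> \<omega>"
  then obtain U V \<Phi> where *: "local_equivalence G P act \<theta> \<omega> U V \<Phi>" "p \<in> U" "\<Phi> p = q"
    unfolding equivalence_rel_def by blast
  then have bij: "bij_betw \<Phi> U V" unfolding local_equivalence_def by blast
  have "q \<in> V" "inv_into U \<Phi> q = p"
    using bij_betw_apply[OF bij *(2)] bij_betw_inv_into_left[OF bij *(2)] *(3) by simp_all
  then show "(q, p) \<in> equivalence_rel G P act \<theta> \<omega>"
    using local_equivalence_inverse[OF assms *(1)] unfolding equivalence_rel_def by blast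
qed

lemma trans_equivalence_rel:
  assumes "smooth_manifold P" "model P = UNIV"
  shows "trans (equivalence_rel G P act \<theta> \<omega>)"
proof (rule transI)
  fix p q r assume "(p, q) \<in> equivalence_rel G P act \<theta> \<omega>" "(q, r) \<in> equivalence_rel G P act \<theta> \<omega>"
  then obtain U V \<Phi> U' V' \<Psi> where *: "local_equivalence G P act \<theta> \<omega> U V \<Phi>" "p \<in> U" "\<Phi> p = q"
    "local_equivalence G P act \<theta> \<omega> U' V' \<Psi>" "q \<in> U'" "\<Psi> q = r"
    unfolding equivalence_rel_def by blast
  have "\<exists>U V \<Phi>. local_equivalence G P act \<theta> \<omega> U V \<Phi> \<and> p \<in> U \<and> \<Phi> p = r"
    by (intro exI conjI, rule local_equivalence_compose[OF assms *(1,4)])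
       (use *(2,3,5,6) in simp_all)
  then show "(p, r) \<in> equivalence_rel G P act \<theta> \<omega>"
    unfolding equivalence_rel_def by simp
qed

lemma equivalence_rel_subset: "equivalence_rel G P act \<theta> \<omega> \<subseteq> pts P \<times> pts P"
proof clarify
  fix p q assume "(p, q) \<in> equivalence_rel G P act \<theta> \<omega>"
  then obtain U V \<Phi> where *: "local_equivalence G P act \<theta> \<omega> U V \<Phi>" "p \<in> U" "\<Phi> p = q"
    unfolding equivalence_rel_def by blast
  then have op: "openin (mtop P) U" "openin (mtop P) V" and bij: "bij_betw \<Phi> U V"
    unfolding local_equivalence_def by blast+
  have "q \<in> V" using bij_betw_apply[OF bij *(2)] *(3) by simp
  with *(2) op[THEN openin_subset] show "p \<in> pts P \<and> q \<in> pts P" by blast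
qed

lemma classifying_map_eq_iff:
  assumes "smooth_manifold P" "model P = UNIV" "smooth_right_action G P act" "q \<in> pts P"
  shows "classifying_map G P act \<theta> \<omega> p = classifying_map G P act \<theta> \<omega> q \<longleftrightarrow>
    (p, q) \<in> equivalence_rel G P act \<theta> \<omega>"
proof
  assume "classifying_map G P act \<theta> \<omega> p = classifying_map G P act \<theta> \<omega> q"
  then show "(p, q) \<in> equivalence_rel G P act \<theta> \<omega>"
    using equivalence_rel_refl[OF assms] unfolding classifying_map_def by blast
next
  assume "(p, q) \<in> equivalence_rel G P act \<theta> \<omega>"
  then show "classifying_map G P act \<theta> \<omega> p = classifying_map G P act \<theta> \<omega> q"
    using symD[OF sym_equivalence_rel[OF assms(1,2)]] transD[OF trans_equivalence_rel[OF assms(1,2)]]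
    unfolding classifying_map_def by blast
qed

text \<open>Points outside the manifold are related to nothing, so their class is empty, whereas every
point of the quotient is a nonempty class. Hence pullbacks vanish outside the manifold, as the
extension by 0 of differential forms requires.\<close>

lemma classifying_map_outside:
  assumes "smooth_manifold P" "model P = UNIV" "smooth_right_action G P act" "p \<notin> pts P"
  shows "classifying_map G P act \<theta> \<omega> p \<notin> pts P // equivalence_rel G P act \<theta> \<omega>"
proof
  assume "classifying_map G P act \<theta> \<omega> p \<in> pts P // equivalence_rel G P act \<theta> \<omega>"
  then obtain q where "q \<in> pts P" "equivalence_rel G P act \<theta> \<omega> `` {p} = equivalence_rel G P act \<theta> \<omega> `` {q}"
    unfolding classifying_map_def by (auto elim: quotientE)
  then have "(p, q) \<in> equivalence_rel G P act \<theta> \<omega>"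
    using equivalence_rel_refl[OF assms(1-3)] by blast
  then show False using equivalence_rel_subset assms(4) by blast
qed

section \<open>Forms expressed in a coframe\<close>

lemma alternating_form_outside:
  "alternating_form k V f \<Longrightarrow> \<not> (length vs = k \<and> set vs \<subseteq> V) \<Longrightarrow> f vs = 0"
  unfolding alternating_form_def by blast

lemma alternating_form_linear:
  assumes "alternating_form k V f" "length vs = k" "set vs \<subseteq> V" "i < k" "u \<in> V" "v \<in> V"
  shows "f (vs[i := a *\<^sub>R u + b *\<^sub>R v]) = a * f (vs[i := u]) + b * f (vs[i := v])"
  using assms unfolding alternating_form_def by blast

lemma alternating_form_repeated:
  assumes "alternating_form k V f" "length vs = k" "set vs \<subseteq> V" "i < k" "j < k" "i \<noteq> j" "vs ! i = vs ! j"
  shows "f vs = 0"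
  using assms unfolding alternating_form_def by blast

lemma alternating_form_sum:
  assumes f: "alternating_form k V f" and V: "subspace V"
    and len: "length xs + Suc (length ys) = k" and sub: "set xs \<subseteq> V" "set ys \<subseteq> V"
    and "finite B" "\<And>b. b \<in> B \<Longrightarrow> e b \<in> V"
  shows "f (xs @ (\<Sum>b\<in>B. c b *\<^sub>R e b) # ys) = (\<Sum>b\<in>B. c b * f (xs @ e b # ys))"
proof -
  have step: "f (xs @ (a *\<^sub>R u + b *\<^sub>R v) # ys) = a * f (xs @ u # ys) + b * f (xs @ v # ys)"
    if "u \<in> V" "v \<in> V" for a b u v
    using alternating_form_linear[OF f, of "xs @ 0 # ys" "length xs" u v a b] that len sub
      subspace_0[OF V] by simp
  show ?thesis
    using assms(6,7)
  proof (induction B rule: finite_induct)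
    case empty
    then show ?case using step[OF subspace_0[OF V] subspace_0[OF V], of 0 0] by simp
  next
    case (insert b B)
    have "(\<Sum>b\<in>B. c b *\<^sub>R e b) \<in> V"
      using insert.prems by (intro subspace_sum[OF V] subspace_scale[OF V]) auto
    then show ?case
      using insert step[of "e b" "\<Sum>b\<in>B. c b *\<^sub>R e b" "c b" 1] by simp
  qed
qed

lemma alternating_form_compose_linear:
  assumes f: "alternating_form k V f" and L: "linear L" "range L \<subseteq> V"
  shows "alternating_form k UNIV (\<lambda>vs. f (map L vs))"
proof -
  have sub: "set (map L vs) \<subseteq> V" for vs using L(2) by auto
  show ?thesis
    unfolding alternating_form_def
  proof (intro conjI allI impI)
    show "f (map L vs) = 0" if "\<not> (length vs = k \<and> set vs \<subseteq> UNIV)" for vs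
      using that by (intro alternating_form_outside[OF f]) simp
    show "f (map L (vs[i := a *\<^sub>R u + b *\<^sub>R v])) = a * f (map L (vs[i := u])) + b * f (map L (vs[i := v]))"
      if "length vs = k \<and> set vs \<subseteq> UNIV \<and> i < k \<and> u \<in> UNIV \<and> v \<in> UNIV" for vs i u v a b
      using alternating_form_linear[OF f _ sub, of vs i "L u" "L v" a b] that L
      by (simp add: map_update linear_add linear_scale range_subsetD)
    show "f (map L vs) = 0"
      if "length vs = k \<and> set vs \<subseteq> UNIV \<and> i < k \<and> j < k \<and> i \<noteq> j \<and> vs ! i = vs ! j" for vs i j
      using alternating_form_repeated[OF f _ sub, of vs i j] that by simp
  qed
qed

text \<open>A form is transported to a subspace by a map \<open>J\<close> that is linear only there, such as the inverse
of a linear embedding with range \<open>V\<close>.\<close>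

lemma alternating_form_restrict:
  assumes f: "alternating_form k UNIV f" and V: "subspace V"
    and J: "\<And>a b u v. u \<in> V \<Longrightarrow> v \<in> V \<Longrightarrow> J (a *\<^sub>R u + b *\<^sub>R v) = a *\<^sub>R J u + b *\<^sub>R J v"
  shows "alternating_form k V (\<lambda>vs. if length vs = k \<and> set vs \<subseteq> V then f (map J vs) else 0)"
proof -
  have upd: "set (vs[i := u]) \<subseteq> V" if "set vs \<subseteq> V" "u \<in> V" for vs i u
    using set_update_subset_insert[of vs i u] that by blast
  show ?thesis
    unfolding alternating_form_def
  proof (intro conjI allI impI)
    fix vs i u v and a b :: real
    assume *: "length vs = k \<and> set vs \<subseteq> V \<and> i < k \<and> u \<in> V \<and> v \<in> V"
    then have "a *\<^sub>R u + b *\<^sub>R v \<in> V" by (intro subspace_add[OF V] subspace_scale[OF V]) auto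
    with * show "(if length (vs[i := a *\<^sub>R u + b *\<^sub>R v]) = k \<and> set (vs[i := a *\<^sub>R u + b *\<^sub>R v]) \<subseteq> V
          then f (map J (vs[i := a *\<^sub>R u + b *\<^sub>R v])) else 0) =
        a * (if length (vs[i := u]) = k \<and> set (vs[i := u]) \<subseteq> V then f (map J (vs[i := u])) else 0) +
        b * (if length (vs[i := v]) = k \<and> set (vs[i := v]) \<subseteq> V then f (map J (vs[i := v])) else 0)"
      using alternating_form_linear[OF f, of "map J vs" i "J u" "J v" a b]
      by (simp add: upd map_update J)
  next
    fix vs i j
    assume "length vs = k \<and> set vs \<subseteq> V \<and> i < k \<and> j < k \<and> i \<noteq> j \<and> vs ! i = vs ! j"
    then show "(if length vs = k \<and> set vs \<subseteq> V then f (map J vs) else 0) = 0"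
      using alternating_form_repeated[OF f, of "map J vs" i j] by simp
  qed auto
qed

text \<open>A family of forms whose values on constant vectors are \<open>C\<^sup>m\<close> has \<open>C\<^sup>m\<close> values on \<open>C\<^sup>m\<close> vector
functions. The arguments are made constant one at a time, from the last to the first, by expanding
each of them in an orthonormal basis of \<open>V\<close>; this avoids sums over multi-indices.\<close>

lemma Ck_on_alternating_form_apply:
  fixes \<alpha> :: "'a::euclidean_space \<Rightarrow> 'v::euclidean_space list \<Rightarrow> real"
  assumes S: "open S" and V: "subspace V"
    and alt: "\<And>x. x \<in> S \<Longrightarrow> alternating_form k V (\<alpha> x)"
    and \<alpha>: "\<And>ws. length ws = k \<Longrightarrow> set ws \<subseteq> V \<Longrightarrow> Ck_on m S (\<lambda>x. \<alpha> x ws)"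
    and fs: "length fs = k" "\<And>f. f \<in> set fs \<Longrightarrow> Ck_on m S f" "\<And>f x. f \<in> set fs \<Longrightarrow> x \<in> S \<Longrightarrow> f x \<in> V"
  shows "Ck_on m S (\<lambda>x. \<alpha> x (map (\<lambda>f. f x) fs))"
proof -
  obtain B where B: "B \<subseteq> V" "pairwise orthogonal B" "\<And>b. b \<in> B \<Longrightarrow> norm b = 1"
    "independent B" "span B = V"
    using orthonormal_basis_subspace[OF V] by metis
  have fin: "finite B" using B(4) by (rule independent_imp_finite)
  \<comment> \<open>The constant arguments \<open>ws\<close> are those that have already been expanded.\<close>
  have "Ck_on m S (\<lambda>x. \<alpha> x (map (\<lambda>f. f x) fs @ ws))"
    if "length fs + length ws = k" "set ws \<subseteq> V" for ws
    using that fs(2,3)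
  proof (induction fs arbitrary: ws rule: rev_induct)
    case Nil
    then show ?case using \<alpha> by simp
  next
    case (snoc f fs)
    have f: "Ck_on m S f" "\<And>x. x \<in> S \<Longrightarrow> f x \<in> V" using snoc.prems(3,4) by simp_all
    show ?case
    proof (rule Ck_on_cong[OF S])
      show "Ck_on m S (\<lambda>x. \<Sum>b\<in>B. (f x \<bullet> b) *\<^sub>R \<alpha> x (map (\<lambda>f. f x) fs @ b # ws))"
      proof (intro Ck_on_sum[OF S] Ck_on_scaleR[OF S])
        fix b assume b: "b \<in> B"
        show "Ck_on m S (\<lambda>x. f x \<bullet> b)"
          by (rule Ck_on_bounded_linear[OF S bounded_linear_inner_left f(1)])
        show "Ck_on m S (\<lambda>x. \<alpha> x (map (\<lambda>f. f x) fs @ b # ws))"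
          by (rule snoc.IH) (use snoc.prems b B(1) in auto)
      qed
      fix x assume x: "x \<in> S"
      have "(\<Sum>b\<in>B. (f x \<bullet> b) *\<^sub>R b) = f x"
        by (rule orthonormal_basis_expand[OF B(2,3) _ fin]) (use f(2)[OF x] B(5) in auto)
      moreover have "\<alpha> x (map (\<lambda>f. f x) fs @ (\<Sum>b\<in>B. (f x \<bullet> b) *\<^sub>R b) # ws) =
          (\<Sum>b\<in>B. (f x \<bullet> b) * \<alpha> x (map (\<lambda>f. f x) fs @ b # ws))"
        by (rule alternating_form_sum[OF alt[OF x] V _ _ _ fin])
           (use snoc.prems x B(1) in auto)
      ultimately show "(\<Sum>b\<in>B. (f x \<bullet> b) *\<^sub>R \<alpha> x (map (\<lambda>f. f x) fs @ b # ws)) =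
          \<alpha> x (map (\<lambda>f. f x) (fs @ [f]) @ ws)"
        by simp
    qed
  qed
  from this[of "[]"] fs(1) show ?thesis by simp
qed

lemma vector_valued_one_form_smooth:
  "vector_valued_one_form M L \<Longrightarrow> (U, \<phi>) \<in> atlas M \<Longrightarrow>
    smooth_on (\<phi> ` U) (\<lambda>x. L (inv_into U \<phi> x) (coord_vec M (U, \<phi>) (inv_into U \<phi> x) v))"
  unfolding vector_valued_one_form_def by (auto simp: Let_def)

text \<open>With this, the coframe \<open>(\<theta>, \<omega>)\<close> can be treated as a single one-form.\<close>

lemma vector_valued_one_form_Pair:
  assumes M: "smooth_manifold M" "model M = UNIV"
    and "vector_valued_one_form M \<theta>" "vector_valued_one_form M \<omega>"
  shows "vector_valued_one_form M (\<lambda>p \<xi>. (\<theta> p \<xi>, \<omega> p \<xi>))"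
  unfolding vector_valued_one_form_def Let_def
proof (intro conjI ballI, safe)
  fix p assume "p \<in> pts M"
  then have "linear (\<theta> p)" "linear (\<omega> p)" using assms(3,4) unfolding vector_valued_one_form_def by blast+
  then show "linear (\<lambda>\<xi>. (\<theta> p \<xi>, \<omega> p \<xi>))"
    by (auto simp: linear_iff)
next
  fix U \<phi> v assume c: "(U, \<phi>) \<in> atlas M"
  have op: "open (\<phi> ` U)" by (rule chart_image_open_UNIV[OF M c chart_open[OF M(1) c]]) simp
  let ?t = "\<lambda>x. \<theta> (inv_into U \<phi> x) (coord_vec M (U, \<phi>) (inv_into U \<phi> x) v)"
  let ?o = "\<lambda>x. \<omega> (inv_into U \<phi> x) (coord_vec M (U, \<phi>) (inv_into U \<phi> x) v)"
  have "Ck_on k (\<phi> ` U) (\<lambda>x. (?t x, 0) + (0, ?o x))" for k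
    by (intro Ck_on_add[OF op])
       (rule Ck_on_bounded_linear[OF op _ smooth_on_imp_Ck_on[OF op vector_valued_one_form_smooth[OF assms(3) c]]]
          Ck_on_bounded_linear[OF op _ smooth_on_imp_Ck_on[OF op vector_valued_one_form_smooth[OF assms(4) c]]];
        intro bounded_linear_Pair bounded_linear_ident bounded_linear_zero)+
  then show "smooth_on (\<phi> ` U) (\<lambda>x. (?t x, ?o x))" by (intro smooth_on_openI[OF op]) simp
qed

lemma smooth_fun_cong:
  assumes M: "smooth_manifold M" and "smooth_fun M f" "\<And>p. p \<in> pts M \<Longrightarrow> f p = g p"
  shows "smooth_fun M g"
  unfolding smooth_fun_def
proof safe
  fix U \<phi> assume c: "(U, \<phi>) \<in> atlas M"
  have "smooth_on (\<phi> ` U) (\<lambda>x. f (inv_into U \<phi> x))" using assms(2) c unfolding smooth_fun_def by blast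
  then show "smooth_on (\<phi> ` U) (\<lambda>x. g (inv_into U \<phi> x))"
    by (rule smooth_on_cong) (use chart_subset_pts[OF M c] assms(3) in \<open>auto simp: inv_chart[OF M c]\<close>)
qed

text \<open>In a chart, the value on coordinate vectors is a form with smooth coefficients \<open>\<eta>(h p)\<close>, applied to
the smooth \<open>V\<close>-valued functions that the coframe assigns to the coordinate vector fields.\<close>

lemma smooth_form_pullback:
  fixes M :: "('p, 'e::euclidean_space) mfd" and X :: "('x, 'f::euclidean_space) mfd"
    and L :: "'p \<Rightarrow> 'e \<Rightarrow> 'v::euclidean_space"
  assumes M: "smooth_manifold M" "model M = UNIV" and X: "smooth_manifold X"
    and h: "smooth_map M (pts M) X h" "\<And>p. p \<notin> pts M \<Longrightarrow> h p \<notin> pts X"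
    and L: "vector_valued_one_form M L" "\<And>p. p \<in> pts M \<Longrightarrow> range (L p) = V"
    and \<eta>: "\<eta> \<in> trivial_bundle_forms X V k"
  shows "(\<lambda>p \<xi>s. \<eta> (h p) (map (L p) \<xi>s)) \<in> diff_forms M k"
proof -
  have alt: "alternating_form k V (\<eta> (h p))" if "p \<in> pts M" for p
    using \<eta> smooth_map_in_pts[OF h(1) that] unfolding trivial_bundle_forms_def by blast
  have lin: "linear (L p)" if "p \<in> pts M" for p
    using L(1) that unfolding vector_valued_one_form_def by blast
  have sm: "smooth_fun X (\<lambda>x. \<eta> x ws)" if "length ws = k" "set ws \<subseteq> V" for ws
    using \<eta> that unfolding trivial_bundle_forms_def by blast
  show ?thesis
    unfolding diff_forms_def Let_def
  proof (rule CollectI, intro conjI, safe)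
    show "alternating_form k UNIV (\<lambda>\<xi>s. \<eta> (h p) (map (L p) \<xi>s))" if "p \<in> pts M" for p
      using alternating_form_compose_linear[OF alt[OF that] lin[OF that]] L(2)[OF that] by blast
    show "\<eta> (h p) (map (L p) vs) = 0" if "p \<notin> pts M" for p vs
      using \<eta> h(2)[OF that] unfolding trivial_bundle_forms_def by blast
    fix U \<phi> and vs :: "'e list" assume c: "(U, \<phi>) \<in> atlas M" and k: "k = length vs"
    have op: "open (\<phi> ` U)" by (rule chart_image_open_UNIV[OF M c chart_open[OF M(1) c]]) simp
    have pts: "inv_into U \<phi> x \<in> pts M" if "x \<in> \<phi> ` U" for x
      using that chart_subset_pts[OF M(1) c] inv_into_into[OF that] by blast
    let ?f = "\<lambda>v x. L (inv_into U \<phi> x) (coord_vec M (U, \<phi>) (inv_into U \<phi> x) v)"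
    show "smooth_on (\<phi> ` U) (\<lambda>x. \<eta> (h (inv_into U \<phi> x))
        (map (L (inv_into U \<phi> x)) (map (coord_vec M (U, \<phi>) (inv_into U \<phi> x)) vs)))"
    proof (cases "U = {}")
      case True
      then show ?thesis by (simp add: smooth_on_def)
    next
      case False
      then obtain p where p: "p \<in> pts M" using pts by blast
      have V: "subspace V" using linear_subspace_image[OF lin[OF p] subspace_UNIV] L(2)[OF p] by simp
      have "Ck_on m (\<phi> ` U) (\<lambda>x. \<eta> (h (inv_into U \<phi> x)) (map (\<lambda>f. f x) (map ?f vs)))" for m
      proof (rule Ck_on_alternating_form_apply[OF op V, where \<alpha> = "\<lambda>x. \<eta> (h (inv_into U \<phi> x))"])
        show "alternating_form k V (\<eta> (h (inv_into U \<phi> x)))" if "x \<in> \<phi> ` U" for x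
          by (rule alt[OF pts[OF that]])
        show "Ck_on m (\<phi> ` U) (\<lambda>x. \<eta> (h (inv_into U \<phi> x)) ws)" if "length ws = k" "set ws \<subseteq> V" for ws
          using smooth_fun_compose[OF M(1) X h(1) sm[OF that]] c
          unfolding smooth_fun_def by (intro smooth_on_imp_Ck_on[OF op]) blast
        show "length (map ?f vs) = k" using k by simp
        show "Ck_on m (\<phi> ` U) f" if "f \<in> set (map ?f vs)" for f
          using that smooth_on_imp_Ck_on[OF op vector_valued_one_form_smooth[OF L(1) c]] by auto
        show "f x \<in> V" if "f \<in> set (map ?f vs)" "x \<in> \<phi> ` U" for f x
          using that L(2)[OF pts[OF that(2)]] by auto
      qed
      then show ?thesis by (intro smooth_on_openI[OF op]) (simp add: comp_def)
    qed
  qed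
qed

text \<open>The frame vector \<open>L\<^sub>p\<inverse> w\<close> has smooth coordinates in every chart because they solve a linear
system: the matrix is the coframe applied to the coordinate vectors, the right-hand side is the constant \<open>w\<close>. The value
of the form on these vector fields is then smooth by multilinearity.\<close>

lemma smooth_form_in_frame:
  fixes M :: "('p, 'e::euclidean_space) mfd" and L :: "'p \<Rightarrow> 'e \<Rightarrow> 'v::euclidean_space"
  assumes M: "smooth_manifold M" "model M = UNIV"
    and L: "vector_valued_one_form M L" "\<And>p. p \<in> pts M \<Longrightarrow> inj (L p)" "\<And>p. p \<in> pts M \<Longrightarrow> range (L p) = V"
    and \<Omega>: "\<Omega> \<in> diff_forms M k" and ws: "length ws = k" "set ws \<subseteq> V"
  shows "smooth_fun M (\<lambda>p. \<Omega> p (map (inv (L p)) ws))"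
  unfolding smooth_fun_def
proof safe
  fix U \<phi> assume c: "(U, \<phi>) \<in> atlas M"
  have op: "open (\<phi> ` U)" by (rule chart_image_open_UNIV[OF M c chart_open[OF M(1) c]]) simp
  have inU: "inv_into U \<phi> x \<in> U" if "x \<in> \<phi> ` U" for x using that by (rule inv_into_into)
  have pts: "inv_into U \<phi> x \<in> pts M" if "x \<in> \<phi> ` U" for x
    using inU[OF that] chart_subset_pts[OF M(1) c] by blast
  let ?T = "\<lambda>x. coord_vec M (U, \<phi>) (inv_into U \<phi> x)"
  let ?A = "\<lambda>x v. L (inv_into U \<phi> x) (?T x v)"
  have T: "linear (?T x)" "bij (?T x)" if "x \<in> \<phi> ` U" for x
    using coord_vec_bij[OF M c inU[OF that]] by blast+
  have lin: "linear (L p)" if "p \<in> pts M" for p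
    using L(1) that unfolding vector_valued_one_form_def by blast
  have A: "linear (?A x)" "inj (?A x)" if x: "x \<in> \<phi> ` U" for x
    using linear_compose[OF T(1)[OF x] lin[OF pts[OF x]]]
      inj_compose[OF L(2)[OF pts[OF x]] bij_is_inj[OF T(2)[OF x]]] by (simp_all add: comp_def)
  \<comment> \<open>The components of the frame vector \<open>w\<close> with respect to the coordinate vectors of the chart.\<close>
  let ?c = "\<lambda>w x. inv (?T x) (inv (L (inv_into U \<phi> x)) w)"
  have Tc: "?T x (?c w x) = inv (L (inv_into U \<phi> x)) w" if "x \<in> \<phi> ` U" for x w
    by (rule surj_f_inv_f[OF bij_is_surj[OF T(2)[OF that]]])
  have Ac: "?A x (?c w x) = w" if "x \<in> \<phi> ` U" "w \<in> V" for x w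
    using Tc[OF that(1)] that(2) L(3)[OF pts[OF that(1)]] by (simp add: f_inv_into_f)
  have ck: "Ck_on m (\<phi> ` U) (?c w)" if "w \<in> V" for m w
  proof (rule Ck_on_linear_system_solution[OF op, where A = ?A and v = "\<lambda>_. w"])
    show "Ck_on m (\<phi> ` U) (\<lambda>x. ?A x b)" for b
      by (rule smooth_on_imp_Ck_on[OF op vector_valued_one_form_smooth[OF L(1) c]])
    show "?A x (?c w x) = w" if "x \<in> \<phi> ` U" for x by (rule Ac[OF that \<open>w \<in> V\<close>])
  qed (use A Ck_on_const in auto)
  have alt: "alternating_form k UNIV (\<Omega> p)" if "p \<in> pts M" for p
    using \<Omega> that unfolding diff_forms_def by blast
  have sm: "smooth_on (\<phi> ` U) (\<lambda>x. \<Omega> (inv_into U \<phi> x) (map (?T x) vs))" if "length vs = k" for vs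
    using \<Omega> c that unfolding diff_forms_def by (auto simp: Let_def)
  have "Ck_on m (\<phi> ` U) (\<lambda>x. \<Omega> (inv_into U \<phi> x) (map (?T x) (map (\<lambda>f. f x) (map ?c ws))))" for m
  proof (rule Ck_on_alternating_form_apply[OF op subspace_UNIV,
        where \<alpha> = "\<lambda>x vs. \<Omega> (inv_into U \<phi> x) (map (?T x) vs)"])
    show "alternating_form k UNIV (\<lambda>vs. \<Omega> (inv_into U \<phi> x) (map (?T x) vs))" if "x \<in> \<phi> ` U" for x
      by (rule alternating_form_compose_linear[OF alt[OF pts[OF that]] T(1)[OF that]]) simp
    show "Ck_on m (\<phi> ` U) (\<lambda>x. \<Omega> (inv_into U \<phi> x) (map (?T x) vs))" if "length vs = k" for vs
      by (rule smooth_on_imp_Ck_on[OF op sm[OF that]])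
  qed (use ws ck in auto)
  then have "smooth_on (\<phi> ` U) (\<lambda>x. \<Omega> (inv_into U \<phi> x) (map (?T x) (map (\<lambda>f. f x) (map ?c ws))))"
    by (rule smooth_on_openI[OF op])
  then show "smooth_on (\<phi> ` U) (\<lambda>x. \<Omega> (inv_into U \<phi> x) (map (inv (L (inv_into U \<phi> x))) ws))"
  proof (rule smooth_on_cong)
    show "\<Omega> (inv_into U \<phi> x) (map (?T x) (map (\<lambda>f. f x) (map ?c ws))) =
        \<Omega> (inv_into U \<phi> x) (map (inv (L (inv_into U \<phi> x))) ws)" if "x \<in> \<phi> ` U" for x
      using Tc[OF that] by (simp add: comp_def)
  qed
qed

section \<open>Invariant forms\<close>

text \<open>That \<open>\<gg>\<close> is a linear subspace follows here from the connection, as \<open>\<gg>\<close> is the range of the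
linear map \<open>\<omega>\<^sub>p\<close>; the closed subgroup theorem is avoided. A preimage of \<open>(v, \<alpha>)\<close> is found by choosing
\<open>\<xi>\<close> with \<open>\<theta>\<^sub>p \<xi> = v\<close> and correcting it by the fundamental vector of \<open>\<alpha> - \<omega>\<^sub>p \<xi>\<close>, which \<open>\<theta>\<^sub>p\<close> does
not see.\<close>

lemma coframe_iso:
  fixes \<theta> :: "'p \<Rightarrow> 'e::euclidean_space \<Rightarrow> real^'n"
  assumes "G_structure G P act \<theta>" "is_connection G P act \<omega>" and p: "p \<in> pts P"
  shows "linear (\<lambda>\<xi>. (\<theta> p \<xi>, \<omega> p \<xi>))" "inj (\<lambda>\<xi>. (\<theta> p \<xi>, \<omega> p \<xi>))"
    "range (\<lambda>\<xi>. (\<theta> p \<xi>, \<omega> p \<xi>)) = coframe_fibre G" "subspace (coframe_fibre G)"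
proof -
  let ?L = "\<lambda>\<xi>. (\<theta> p \<xi>, \<omega> p \<xi>)"
  have lt: "linear (\<theta> p)" and surj: "surj (\<theta> p)" and dim: "DIM('e) = CARD('n) + dim (lie_algebra G)"
    and th0: "\<And>\<alpha>. \<alpha> \<in> lie_algebra G \<Longrightarrow> \<theta> p (fund_vec P act \<alpha> p) = 0"
    using assms(1) p unfolding G_structure_def vector_valued_one_form_def by blast+
  have lo: "linear (\<omega> p)" and oin: "\<And>\<xi>. \<omega> p \<xi> \<in> lie_algebra G"
    and om: "\<And>\<alpha>. \<alpha> \<in> lie_algebra G \<Longrightarrow> \<omega> p (fund_vec P act \<alpha> p) = \<alpha>"
    using assms(2) p unfolding is_connection_def vector_valued_one_form_def by blast+
  show lin: "linear ?L" using lt lo by (auto simp: linear_iff)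
  have "range (\<omega> p) = lie_algebra G" using oin om by (metis image_subset_iff rangeI subsetI subset_antisym)
  then have sub: "subspace (lie_algebra G)" using linear_subspace_image[OF lo subspace_UNIV] by simp
  show rng: "range ?L = coframe_fibre G"
  proof
    show "range ?L \<subseteq> coframe_fibre G" using oin by (auto simp: coframe_fibre_def)
    show "coframe_fibre G \<subseteq> range ?L"
    proof
      fix w assume "w \<in> coframe_fibre G"
      then obtain v \<alpha> where w: "w = (v, \<alpha>)" "\<alpha> \<in> lie_algebra G" by (auto simp: coframe_fibre_def)
      obtain \<xi> where \<xi>: "\<theta> p \<xi> = v" using surj by (metis surjD)
      let ?\<beta> = "\<alpha> - \<omega> p \<xi>"
      have "?\<beta> \<in> lie_algebra G" using w(2) oin by (intro subspace_diff[OF sub])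
      then have "?L (\<xi> + fund_vec P act ?\<beta> p) = w"
        using th0 om w(1) \<xi> by (simp add: linear_add[OF lt] linear_add[OF lo])
      then show "w \<in> range ?L" by (rule range_eqI[OF sym])
    qed
  qed
  show subV: "subspace (coframe_fibre G)"
    using linear_subspace_image[OF lin subspace_UNIV] rng by simp
  \<comment> \<open>Injectivity: a right inverse embeds a space of full dimension, so it is onto.\<close>
  obtain R where R: "linear R" "\<And>w. w \<in> coframe_fibre G \<Longrightarrow> ?L (R w) = w"
    using linear_exists_right_inverse_on[OF lin subspace_UNIV] unfolding rng by blast
  have "inj_on R (coframe_fibre G)" by (metis R(2) inj_onI)
  then have "dim (R ` coframe_fibre G) = dim (coframe_fibre G)"
    using subV by (intro dim_image_eq[OF R(1)]) (simp add: span_eq_iff[THEN iffD2])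
  also have "\<dots> = DIM('e)"
    using dim by (simp add: coframe_fibre_def dim_Times[OF subspace_UNIV sub])
  finally have "span (R ` coframe_fibre G) = UNIV" by (simp add: dim_eq_full)
  then have full: "R ` coframe_fibre G = UNIV"
    using linear_subspace_image[OF R(1) subV] by (simp add: span_eq_iff[THEN iffD2])
  show "inj ?L"
  proof (rule injI)
    fix \<xi> \<zeta> assume eq: "?L \<xi> = ?L \<zeta>"
    obtain u v where "\<xi> = R u" "u \<in> coframe_fibre G" "\<zeta> = R v" "v \<in> coframe_fibre G"
      using full by (metis UNIV_I imageE)
    then show "\<xi> = \<zeta>" using eq R(2) by metis
  qed
qed

theorem proposition3p11:
  fixes G :: "(real^'n^'n) set"
    and P :: "('p, 'e::euclidean_space) mfd"
    and act :: "'p \<Rightarrow> real^'n^'n \<Rightarrow> 'p"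
    and \<theta> :: "'p \<Rightarrow> 'e \<Rightarrow> real^'n"
    and \<omega> :: "'p \<Rightarrow> 'e \<Rightarrow> real^'n^'n"
    and X :: "('p set, 'e) mfd"
    and d k :: nat
  defines "h \<equiv> classifying_map G P act \<theta> \<omega>"
    and "H \<equiv> coframe_map G P act \<theta> \<omega>"
    and "V \<equiv> coframe_fibre G"
  assumes "G_structure G P act \<theta>"
    and "is_connection G P act \<omega>"
    and "fully_regular G P act \<theta> \<omega> d"
    and "classifying_manifold G P act \<theta> \<omega> d X"
  shows "(\<forall>p\<in>pts P. linear (\<lambda>\<xi>. snd (H p \<xi>)) \<and> bij_betw (H p) UNIV ({h p} \<times> V)) \<and>
    inj_on (bundle_pullback h H) (trivial_bundle_forms X V k) \<and>
    bundle_pullback h H ` trivial_bundle_forms X V k = invariant_forms G P act \<theta> \<omega> k \<and>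
    (\<forall>\<eta>\<in>trivial_bundle_forms X V k. \<forall>\<zeta>\<in>trivial_bundle_forms X V k. \<forall>a b.
      bundle_pullback h H (\<lambda>x ws. a * \<eta> x ws + b * \<zeta> x ws) =
      (\<lambda>p \<xi>s. a * bundle_pullback h H \<eta> p \<xi>s + b * bundle_pullback h H \<zeta> p \<xi>s))"
proof -
  define L where "L p \<xi> = (\<theta> p \<xi>, \<omega> p \<xi>)" for p \<xi>
  let ?R = "equivalence_rel G P act \<theta> \<omega>"
  have P: "smooth_manifold P" "model P = UNIV" and act: "smooth_right_action G P act"
    and th: "vector_valued_one_form P \<theta>"
    using assms(4) unfolding G_structure_def by blast+
  have om: "vector_valued_one_form P \<omega>" using assms(5) unfolding is_connection_def by blast
  have X: "smooth_manifold X" and ptsX: "pts X = pts P // ?R" and hs: "smooth_map P (pts P) X h"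
    and submersion: "\<And>p. p \<in> pts P \<Longrightarrow> range (tangent_map P X h p) = model X"
    using assms(7) unfolding classifying_manifold_def h_def by blast+
  have L1: "vector_valued_one_form P L"
    using vector_valued_one_form_Pair[OF P th om] unfolding L_def .
  have L: "linear (L p)" "inj (L p)" "range (L p) = V" "subspace V" if "p \<in> pts P" for p
    using coframe_iso[OF assms(4,5) that] unfolding L_def V_def by simp_all
  have H: "H p \<xi> = (h p, L p \<xi>)" for p \<xi> by (simp add: H_def h_def L_def coframe_map_def)
  have pullback: "bundle_pullback h H \<eta> = (\<lambda>p \<xi>s. \<eta> (h p) (map (L p) \<xi>s))" for \<eta>
    by (simp add: bundle_pullback_def H fun_eq_iff)
  have h_eq: "h p = h q \<longleftrightarrow> (p, q) \<in> ?R" if "q \<in> pts P" for p q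
    using classifying_map_eq_iff[OF P act that] unfolding h_def .
  have h_in: "h p \<in> pts X" if "p \<in> pts P" for p by (rule smooth_map_in_pts[OF hs that order_refl])
  have h_out: "h p \<notin> pts X" if "p \<notin> pts P" for p
    using classifying_map_outside[OF P act that] unfolding h_def ptsX .
  have h_surj: "pts X \<subseteq> h ` pts P"
    unfolding ptsX h_def classifying_map_def by (auto elim: quotientE)
  have Linv: "inv (L p) (L p \<xi>) = \<xi>" if "p \<in> pts P" for p \<xi> by (rule inv_f_f[OF L(2)[OF that]])
  have invL: "L p (inv (L p) w) = w" if "p \<in> pts P" "w \<in> V" for p w
    using f_inv_into_f[of w "L p" UNIV] L(3)[OF that(1)] that(2) by blast

  have "linear (\<lambda>\<xi>. snd (H p \<xi>)) \<and> bij_betw (H p) UNIV ({h p} \<times> V)" if p: "p \<in> pts P" for p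
  proof
    show "linear (\<lambda>\<xi>. snd (H p \<xi>))" using L(1)[OF p] by (simp add: H)
    have "inj (H p)" using L(2)[OF p] by (auto simp: inj_def H)
    moreover have "range (H p) = {h p} \<times> V" unfolding L(3)[OF p, symmetric] by (auto simp: H)
    ultimately show "bij_betw (H p) UNIV ({h p} \<times> V)" by (simp add: bij_betw_def)
  qed
  moreover have "inj_on (bundle_pullback h H) (trivial_bundle_forms X V k)"
  proof (rule inj_onI)
    fix \<eta> \<zeta> assume \<eta>: "\<eta> \<in> trivial_bundle_forms X V k" and \<zeta>: "\<zeta> \<in> trivial_bundle_forms X V k"
      and eq: "bundle_pullback h H \<eta> = bundle_pullback h H \<zeta>"
    have "\<eta> x ws = \<zeta> x ws" for x ws
    proof (cases "x \<in> pts X")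
      case False
      then show ?thesis using \<eta> \<zeta> unfolding trivial_bundle_forms_def by simp
    next
      case True
      then have alt: "alternating_form k V (\<eta> x)" "alternating_form k V (\<zeta> x)"
        using \<eta> \<zeta> unfolding trivial_bundle_forms_def by blast+
      obtain p where p: "p \<in> pts P" "x = h p" using h_surj True by blast
      show ?thesis
      proof (cases "length ws = k \<and> set ws \<subseteq> V")
        case False
        then show ?thesis using alternating_form_outside alt by metis
      next
        case True
        then have "map (L p) (map (inv (L p)) ws) = ws"
          using invL[OF p(1)] by (auto intro!: map_idI)
        then show ?thesis
          using fun_cong[OF fun_cong[OF eq, of p], of "map (inv (L p)) ws"] p(2)
          by (simp add: pullback)
      qed
    qed
    then show "\<eta> = \<zeta>" by blast
  qed
  moreover have "bundle_pullback h H ` trivial_bundle_forms X V k = invariant_forms G P act \<theta> \<omega> k"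
  proof
    show "bundle_pullback h H ` trivial_bundle_forms X V k \<subseteq> invariant_forms G P act \<theta> \<omega> k"
    proof (rule image_subsetI)
      fix \<eta> assume \<eta>: "\<eta> \<in> trivial_bundle_forms X V k"
      show "bundle_pullback h H \<eta> \<in> invariant_forms G P act \<theta> \<omega> k"
        unfolding invariant_forms_def pullback
      proof (rule CollectI, intro conjI allI impI ballI)
        show "(\<lambda>p \<xi>s. \<eta> (h p) (map (L p) \<xi>s)) \<in> diff_forms P k"
          by (rule smooth_form_pullback[OF P X hs h_out L1 L(3) \<eta>])
        fix U W \<Phi> p and \<xi>s :: "'e list"
        assume loc: "local_equivalence G P act \<theta> \<omega> U W \<Phi>" and p: "p \<in> U"
        then have "(p, \<Phi> p) \<in> ?R" unfolding equivalence_rel_def by blast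
        then have "h (\<Phi> p) = h p" using h_eq equivalence_rel_subset by blast
        moreover have "L (\<Phi> p) (tangent_map P P \<Phi> p \<xi>) = L p \<xi>" for \<xi>
          using loc p unfolding local_equivalence_def L_def by blast
        ultimately show "\<eta> (h (\<Phi> p)) (map (L (\<Phi> p)) (map (tangent_map P P \<Phi> p) \<xi>s)) =
            \<eta> (h p) (map (L p) \<xi>s)"
          by (simp add: comp_def)
      qed
    qed
    show "invariant_forms G P act \<theta> \<omega> k \<subseteq> bundle_pullback h H ` trivial_bundle_forms X V k"
    proof
      fix \<Omega> assume inv\<Omega>: "\<Omega> \<in> invariant_forms G P act \<theta> \<omega> k"
      then have \<Omega>: "\<Omega> \<in> diff_forms P k" unfolding invariant_forms_def by blast
      have alt: "alternating_form k UNIV (\<Omega> p)" if "p \<in> pts P" for p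
        using \<Omega> that unfolding diff_forms_def by blast
      have \<Omega>0: "\<Omega> p vs = 0" if "p \<notin> pts P" for p vs
        using \<Omega> that unfolding diff_forms_def by blast
      \<comment> \<open>The form at \<open>p\<close>, transported to the fibre by the coframe. It depends only on \<open>h p\<close>,
        and therefore defines the section \<open>\<eta>\<close>.\<close>
      define E where "E p ws = (if length ws = k \<and> set ws \<subseteq> V then \<Omega> p (map (inv (L p)) ws) else 0)" for p ws
      have E_inv: "E p = E q" if "p \<in> pts P" "q \<in> pts P" "h p = h q" for p q
      proof
        fix ws
        have "(p, q) \<in> ?R" using h_eq that by blast
        then obtain U W \<Phi> where loc: "local_equivalence G P act \<theta> \<omega> U W \<Phi>" "p \<in> U" "\<Phi> p = q"
          unfolding equivalence_rel_def by blast
        have T: "L q (tangent_map P P \<Phi> p \<xi>) = L p \<xi>" for \<xi>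
          using loc unfolding local_equivalence_def L_def by blast
        have "tangent_map P P \<Phi> p (inv (L p) w) = inv (L q) w" if "w \<in> V" for w
          using T[of "inv (L p) w"] invL[OF \<open>p \<in> pts P\<close> that] Linv[OF \<open>q \<in> pts P\<close>] by metis
        then have "map (tangent_map P P \<Phi> p) (map (inv (L p)) ws) = map (inv (L q)) ws" if "set ws \<subseteq> V"
          using that by auto
        moreover have "\<Omega> q (map (tangent_map P P \<Phi> p) (map (inv (L p)) ws)) = \<Omega> p (map (inv (L p)) ws)"
          if "length ws = k"
        proof -
          have "\<forall>p\<in>U. \<forall>\<xi>s. length \<xi>s = k \<longrightarrow> \<Omega> (\<Phi> p) (map (tangent_map P P \<Phi> p) \<xi>s) = \<Omega> p \<xi>s"
            using inv\<Omega> loc(1) unfolding invariant_forms_def by blast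
          then show ?thesis using loc(2,3) that by (metis length_map)
        qed
        ultimately show "E p ws = E q ws" unfolding E_def by metis
      qed
      define \<eta> where "\<eta> x ws = (if x \<in> pts X then E (SOME p. p \<in> pts P \<and> h p = x) ws else 0)" for x ws
      have \<eta>h: "\<eta> (h p) = E p" if p: "p \<in> pts P" for p
      proof -
        let ?q = "SOME q. q \<in> pts P \<and> h q = h p"
        have "?q \<in> pts P \<and> h ?q = h p" by (rule someI[of _ p]) (simp add: p)
        then have "E ?q = E p" using E_inv p by blast
        then show ?thesis using h_in[OF p] by (simp add: \<eta>_def fun_eq_iff)
      qed
      have "\<eta> \<in> trivial_bundle_forms X V k"
        unfolding trivial_bundle_forms_def
      proof (rule CollectI, intro conjI ballI allI impI)
        show "\<eta> x ws = 0" if "x \<notin> pts X" for x ws using that by (simp add: \<eta>_def)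
        show "alternating_form k V (\<eta> x)" if "x \<in> pts X" for x
        proof -
          obtain p where p: "p \<in> pts P" "x = h p" using h_surj \<open>x \<in> pts X\<close> by blast
          have "alternating_form k V (E p)"
            unfolding E_def
          proof (rule alternating_form_restrict[OF alt[OF p(1)] L(4)[OF p(1)]])
            fix a b u v assume uv: "u \<in> V" "v \<in> V"
            have "L p (a *\<^sub>R inv (L p) u + b *\<^sub>R inv (L p) v) = a *\<^sub>R u + b *\<^sub>R v"
              using invL[OF p(1)] uv by (simp add: linear_add[OF L(1)[OF p(1)]] linear_scale[OF L(1)[OF p(1)]])
            then show "inv (L p) (a *\<^sub>R u + b *\<^sub>R v) = a *\<^sub>R inv (L p) u + b *\<^sub>R inv (L p) v"
              using Linv[OF p(1)] by metis
          qed
          then show ?thesis using \<eta>h p by simp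
        qed
        fix ws assume ws: "length ws = k \<and> set ws \<subseteq> V"
        have "smooth_fun P (\<lambda>p. \<Omega> p (map (inv (L p)) ws))"
          using smooth_form_in_frame[OF P L1 L(2,3) \<Omega>] ws by blast
        then have "smooth_fun P (\<lambda>p. \<eta> (h p) ws)"
          by (rule smooth_fun_cong[OF P(1)]) (use ws in \<open>simp add: \<eta>h E_def\<close>)
        then show "smooth_fun X (\<lambda>x. \<eta> x ws)"
          using smooth_fun_descends_along_submersion[OF P X hs h_surj submersion, of "\<lambda>x. \<eta> x ws"]
          by blast
      qed
      moreover have "\<Omega> = bundle_pullback h H \<eta>"
      proof (intro ext)
        fix p \<xi>s
        show "\<Omega> p \<xi>s = bundle_pullback h H \<eta> p \<xi>s"
        proof (cases "p \<in> pts P")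
          case False
          then show ?thesis using h_out[OF False] \<Omega>0 by (simp add: pullback \<eta>_def)
        next
          case True
          have "map (inv (L p)) (map (L p) \<xi>s) = \<xi>s" using Linv[OF True] by (simp add: comp_def)
          moreover have "set (map (L p) \<xi>s) \<subseteq> V" using L(3)[OF True] by auto
          moreover have "\<Omega> p \<xi>s = 0" if "length \<xi>s \<noteq> k"
            using alternating_form_outside[OF alt[OF True]] that by blast
          ultimately show ?thesis using \<eta>h[OF True] by (auto simp: pullback E_def)
        qed
      qed
      ultimately show "\<Omega> \<in> bundle_pullback h H ` trivial_bundle_forms X V k" by blast
    qed
  qed
  ultimately show ?thesis by (simp add: pullback)
qed

end
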